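(* Let $q$ be a prime power and $n\ge 2d\ge 2$. The minimum cardinality $|T_0\cup T_1|$ of a Steiner $\mathrm{T}_q(d-1,d,n)$ bitrade $(T_0,T_1)$ is $$\prod_{i=1}^{d}(q^{d-i}+1)=\sum_{i=0}^{d}q^{\binom{i}{2}}\left[{d\atop i}\right]_q,$$ and this number equals the w.d. bound $\sum_{i=0}^{\mathrm{D}}|W^i_{A,\theta}|$ for $\Gamma=J_q(n,d)$ and $\theta=-k/s$. Moreover, the subgraph of $J_q(n,d)$ induced by $T_0\cup T_1$ for a Steiner $\mathrm{T}_q(d-1,d,n)$ bitrade of minimum cardinality is a bipartite distance-regular graph with the same intersection array as the dual polar graph $D_d(q)$.
   Context: $\left[{a\atop b}\right]_q=\prod_{i=0}^{b-1}\frac{q^{a-i}-1}{q^{i+1}-1}$. The Grassmann graph $J_q(n,d)$ has as vertices the $d$-dimensional subspaces of $F_q^n$, two being adjacent iff they intersect in a $(d-1)$-dimensional subspace; it is distance-regular of degree $k=q\left[{d\atop 1}\right]_q\left[{n-d\atop 1}\right]_q$, diameter $\mathrm{D}$, intersection numbers $b_i,c_i$, $a_i=k-b_i-c_i$, intersection array $A$. For each $(d-1)$-dimensional subspace, the $d$-subspaces containing it form a clique of size $s+1=\left[{n-d+1\atop 1}\right]_q$; let $S$ be the set of all these cliques. A Steiner $\mathrm{T}_q(d-1,d,n)$ bitrade is a pair $(T_0,T_1)$ of disjoint nonempty sets of vertices such that every clique of $S$ meets each of $T_0,T_1$ in exactly one vertex or meets neither. The w.d. bound: $W^0_{A,\theta}=1$,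 $W^1_{A,\theta}=\theta$, $W^i_{A,\theta}=((\theta-a_{i-1})W^{i-1}_{A,\theta}-b_{i-2}W^{i-2}_{A,\theta})/c_i$ ($i\ge 2$). The dual polar graph $D_d(q)$: vertices are the $d$-dimensional subspaces of $F_q^{2d}$ totally isotropic for the quadratic form $Q_0(v_1,\ldots,v_d,u_1,\ldots,u_d)=v_1u_1+\cdots+v_du_d$ (i.e. $Q_0$ vanishes on them), adjacent iff their intersection has dimension $d-1$; it is distance-regular with intersection array $b'_i=q^i\left[{d-i\atop 1}\right]_q$, $c'_i=\left[{i\atop 1}\right]_q$. *)

theory Defs
  imports "HOL-Analysis.Analysis"
begin

text \<open>
  In \<open>gauss_binomial q a b\<close> the subtraction \<open>a - i\<close> is on natural numbers. If it truncates,
  then \<open>a < i < b\<close>, and the product contains the vanishing factor with index \<open>a\<close> anyway.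
\<close>

definition gauss_binomial :: "nat \<Rightarrow> nat \<Rightarrow> nat \<Rightarrow> real" where
  "gauss_binomial q a b = (\<Prod>i<b. (real q ^ (a - i) - 1) / (real q ^ (i + 1) - 1))"


section \<open>Graphs and intersection arrays\<close>

text \<open>A simple graph is given by its vertices and its symmetric irreflexive adjacency relation.\<close>

record 'v graph =
  verts :: "'v set"
  adj :: "('v \<times> 'v) set"

definition induced_subgraph :: "'v graph \<Rightarrow> 'v set \<Rightarrow> 'v graph" where
  "induced_subgraph G W = \<lparr>verts = W, adj = Restr (adj G) W\<rparr>"

definition connected_graph :: "'v graph \<Rightarrow> bool" where
  "connected_graph G \<longleftrightarrow> verts G \<noteq> {} \<and> (\<forall>x\<in>verts G. \<forall>y\<in>verts G. (x, y) \<in> (adj G)\<^sup>*)"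

definition gdist :: "'v graph \<Rightarrow> 'v \<Rightarrow> 'v \<Rightarrow> nat" where
  "gdist G x y = (LEAST l. (x, y) \<in> adj G ^^ l)"

definition diameter_graph :: "'v graph \<Rightarrow> nat" where
  "diameter_graph G = Max {gdist G x y | x y. x \<in> verts G \<and> y \<in> verts G}"

definition bipartite :: "'v graph \<Rightarrow> bool" where
  "bipartite G \<longleftrightarrow> (\<exists>A B. A \<union> B = verts G \<and> A \<inter> B = {} \<and> adj G \<inter> (A \<times> A \<union> B \<times> B) = {})"

text \<open>
  \<open>distance_regular_with G D b c\<close>: the graph \<open>G\<close> is distance-regular of diameter \<open>D\<close> with
  intersection array \<open>{b 0, \<dots>, b (D - 1); c 1, \<dots>, c D}\<close>. The graph determines \<open>D\<close> and the
  values \<open>b i\<close>, \<open>c i\<close> for \<open>i \<le> D\<close> (with \<open>b D = 0\<close> and \<open>c 0 = 0\<close>); values beyond \<open>D\<close> are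
  unconstrained. The degree is \<open>b 0\<close>.
\<close>

definition distance_regular_with :: "'v graph \<Rightarrow> nat \<Rightarrow> (nat \<Rightarrow> nat) \<Rightarrow> (nat \<Rightarrow> nat) \<Rightarrow> bool" where
  "distance_regular_with G D b c \<longleftrightarrow>
     finite (verts G) \<and> connected_graph G \<and> diameter_graph G = D \<and>
     (\<forall>x\<in>verts G. \<forall>y\<in>verts G.
        card {z \<in> verts G. (y, z) \<in> adj G \<and> gdist G x z = gdist G x y + 1} = b (gdist G x y) \<and>
        card {z \<in> verts G. (y, z) \<in> adj G \<and> gdist G x z + 1 = gdist G x y} = c (gdist G x y))"

text \<open>The numbers \<open>a i = k - b i - c i\<close>, with \<open>k = b 0\<close> the degree, appear inlined.\<close>

fun wd_W :: "(nat \<Rightarrow> nat) \<Rightarrow> (nat \<Rightarrow> nat) \<Rightarrow> real \<Rightarrow> nat \<Rightarrow> real" where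
  "wd_W b c \<theta> 0 = 1"
| "wd_W b c \<theta> (Suc 0) = \<theta>"
| "wd_W b c \<theta> (Suc (Suc i)) =
     ((\<theta> - (real (b 0) - real (b (Suc i)) - real (c (Suc i)))) * wd_W b c \<theta> (Suc i)
       - real (b i) * wd_W b c \<theta> i) / real (c (Suc (Suc i)))"

definition wd_bound :: "nat \<Rightarrow> (nat \<Rightarrow> nat) \<Rightarrow> (nat \<Rightarrow> nat) \<Rightarrow> real \<Rightarrow> real" where
  "wd_bound D b c \<theta> = (\<Sum>i\<le>D. \<bar>wd_W b c \<theta> i\<bar>)"


section \<open>Grassmann graphs and Steiner bitrades\<close>

definition subspaces_of_dim :: "nat \<Rightarrow> ('a::field ^ 'n) set set" where
  "subspaces_of_dim d = {X. vec.subspace X \<and> vec.dim X = d}"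

definition grassmann_graph :: "nat \<Rightarrow> ('a::field ^ 'n) set graph" where
  "grassmann_graph d =
     \<lparr>verts = subspaces_of_dim d,
      adj = {(X, Y). X \<in> subspaces_of_dim d \<and> Y \<in> subspaces_of_dim d \<and> vec.dim (X \<inter> Y) = d - 1}\<rparr>"

definition grassmann_cliques :: "nat \<Rightarrow> ('a::field ^ 'n) set set set" where
  "grassmann_cliques d = {{X \<in> subspaces_of_dim d. U \<subseteq> X} | U. U \<in> subspaces_of_dim (d - 1)}"

definition steiner_bitrade :: "nat \<Rightarrow> ('a::field ^ 'n) set set \<Rightarrow> ('a ^ 'n) set set \<Rightarrow> bool" where
  "steiner_bitrade d T0 T1 \<longleftrightarrow>
     T0 \<subseteq> subspaces_of_dim d \<and> T1 \<subseteq> subspaces_of_dim d \<and>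
     T0 \<noteq> {} \<and> T1 \<noteq> {} \<and> T0 \<inter> T1 = {} \<and>
     (\<forall>C\<in>grassmann_cliques d.
        card (C \<inter> T0) = 1 \<and> card (C \<inter> T1) = 1 \<or> C \<inter> T0 = {} \<and> C \<inter> T1 = {})"

definition minimum_steiner_bitrade ::
    "nat \<Rightarrow> ('a::field ^ 'n) set set \<Rightarrow> ('a ^ 'n) set set \<Rightarrow> bool" where
  "minimum_steiner_bitrade d T0 T1 \<longleftrightarrow>
     steiner_bitrade d T0 T1 \<and>
     (\<forall>(T0' :: ('a ^ 'n) set set) T1'. steiner_bitrade d T0' T1' \<longrightarrow> card (T0 \<union> T1) \<le> card (T0' \<union> T1'))"


section \<open>Dual polar graphs\<close>

text \<open>
  A vector of length \<open>2d\<close> is indexed by the sum type \<open>'m + 'm\<close> with \<open>CARD('m) = d\<close>: its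
  coordinates at \<open>Inl i\<close> are the \<open>v\<^sub>i\<close>, those at \<open>Inr i\<close> the \<open>u\<^sub>i\<close>.
\<close>

definition hyperbolic_form :: "'a::field ^ ('m::finite + 'm) \<Rightarrow> 'a" where
  "hyperbolic_form w = (\<Sum>i\<in>UNIV. w $ Inl i * w $ Inr i)"

definition dual_polar_verts :: "('a::field ^ ('m::finite + 'm)) set set" where
  "dual_polar_verts = {X \<in> subspaces_of_dim CARD('m). \<forall>w\<in>X. hyperbolic_form w = 0}"

definition dual_polar_graph :: "('a::field ^ ('m::finite + 'm)) set graph" where
  "dual_polar_graph =
     \<lparr>verts = dual_polar_verts,
      adj = {(X, Y). X \<in> dual_polar_verts \<and> Y \<in> dual_polar_verts \<and>
                     vec.dim (X \<inter> Y) = CARD('m) - 1}\<rparr>"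

end

theory Submission
  imports Defs
begin

text \<open>
  For a bitrade \<open>(T\<^sub>0, T\<^sub>1)\<close> let \<open>f\<close> be the difference of the indicator functions. The sum of \<open>f\<close>
  over the \<open>d\<close>-subspaces containing a fixed subspace of dimension less than \<open>d\<close> vanishes, so Moebius
  inversion in the subspace lattice of a member \<open>x\<close> shows that for \<open>U \<subseteq> x\<close> of codimension \<open>i\<close> the sum
  of \<open>f\<close> over \<open>{Y. Y \<inter> x = U}\<close> is \<open>(-1)\<^sup>i q\<^bsup>i(i-1)/2\<^esup> f(x)\<close>. Taking absolute values and summing over
  \<open>U\<close> gives the lower bound, by the \<open>q\<close>-binomial theorem. In the case of equality each of these sets has
  exactly \<open>q\<^bsup>i(i-1)/2\<^esup>\<close> members in the bitrade, all of the same sign. Hence each hyperplane of a member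
  \<open>y\<close> lies in exactly one other member, and the sign determines whether that one is closer to \<open>x\<close> than
  \<open>y\<close> or farther away: this gives the intersection numbers.

  The bound is attained by the maximal totally singular subspaces \<open>Y\<close> of a hyperbolic space, split by the
  parity of \<open>dim (Y \<inter> E)\<close> for a fixed one \<open>E\<close>: a totally singular subspace of dimension \<open>d - 1\<close> lies in
  exactly two maximal ones, of different parity. In dimension \<open>2d\<close> these are the vertices of the dual
  polar graph, which is therefore itself an instance of the equality case.
\<close>


section \<open>Counting subspaces\<close>

text \<open>The Gaussian number \<open>gauss_binomial q m 1\<close>, kept as a natural number
  because \<open>distance_regular_with\<close> takes its intersection numbers in
  \<open>nat\<close>.\<close>

definition q_int :: "nat \<Rightarrow> nat \<Rightarrow> nat" where
  "q_int q m = (\<Sum>j<m. q ^ j)"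

lemma q_int_0 [simp]: "q_int q 0 = 0"
  and q_int_1 [simp]: "q_int q (Suc 0) = 1"
  and q_int_Suc: "q_int q (Suc m) = q_int q m + q ^ m"
  by (simp_all add: q_int_def)

lemma q_int_add: "q_int q (a + b) = q_int q a + q ^ a * q_int q b"
  by (induction b) (simp_all add: q_int_Suc power_add algebra_simps)

lemma q_int_pos: "0 < m \<Longrightarrow> 0 < q_int q m"
  by (cases m) (auto simp: q_int_def lessThan_Suc_eq_insert_0)

lemma q_int_mult_real: "real (q_int q m) * (real q - 1) = real q ^ m - 1"
  by (induction m) (simp_all add: q_int_Suc algebra_simps)

lemma q_int_mult:
  assumes "1 \<le> q"
  shows "(q - 1) * q_int q m = q ^ m - 1"
proof -
  have "real ((q - 1) * q_int q m) = real (q ^ m - 1)"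
    using assms q_int_mult_real[of q m] by (simp add: of_nat_diff mult.commute)
  then show ?thesis
    by (simp only: of_nat_eq_iff)
qed

section \<open>Cardinalities, dimensions and one-dimensional extensions of subspaces\<close>

lemma card_field_ge_2: "2 \<le> CARD('a::{field, finite})"
proof -
  have "card {0::'a, 1} \<le> CARD('a)"
    by (rule card_mono) auto
  then show ?thesis
    by simp
qed

lemma card_span_independent:
  fixes B :: "('a::{field, finite} ^ 'n::finite) set"
  assumes "finite B" "vec.independent B"
  shows "card (vec.span B) = CARD('a) ^ card B"
  using assms
proof (induction B)
  case empty
  then show ?case by simp
next
  case (insert b B)
  have B: "vec.independent B" "b \<notin> vec.span B"
    using insert.prems insert.hyps by (auto simp: vec.independent_insert)
  let ?f = "\<lambda>(k, s). s + k *s b"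
  have "vec.span (insert b B) = ?f ` (UNIV \<times> vec.span B)"
  proof (intro set_eqI iffI)
    fix x assume "x \<in> vec.span (insert b B)"
    then obtain k where "x - k *s b \<in> vec.span B"
      by (auto simp: vec.span_breakdown_eq)
    then have "x = ?f (k, x - k *s b)" "(k, x - k *s b) \<in> UNIV \<times> vec.span B"
      by auto
    then show "x \<in> ?f ` (UNIV \<times> vec.span B)"
      by blast
  next
    fix x assume "x \<in> ?f ` (UNIV \<times> vec.span B)"
    then obtain k s where "s \<in> vec.span B" "x = s + k *s b"
      by auto
    then show "x \<in> vec.span (insert b B)"
      unfolding vec.span_breakdown_eq by (intro exI[of _ k]) simp
  qed
  \<comment> \<open>If the coefficients \<open>k\<close> and \<open>l\<close> differed,
    \<open>b\<close> would be a multiple of \<open>t - s\<close> and lie in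
    \<open>vec.span B\<close>.\<close>
  moreover have "inj_on ?f (UNIV \<times> vec.span B)"
  proof (rule inj_onI, clarify)
    fix k l :: 'a and s t
    assume s: "s \<in> vec.span B" "t \<in> vec.span B" and eq: "s + k *s b = t + l *s b"
    have e: "(k - l) *s b = t - s"
      using eq by (simp add: vec.scale_left_diff_distrib algebra_simps)
    have m: "t - s \<in> vec.span B"
      using s by (simp add: vec.span_diff)
    have "k = l"
    proof (rule ccontr)
      assume "k \<noteq> l"
      then have "b = inverse (k - l) *s ((k - l) *s b)"
        by (simp only: vector_smult_assoc) simp
      then have "b \<in> vec.span B"
        using vec.span_scale[OF m] e by metis
      then show False
        using B(2) by contradiction
    qed
    with eq show "k = l \<and> s = t"
      by simp
  qed
  ultimately have "card (vec.span (insert b B)) = card (UNIV \<times> vec.span B :: ('a \<times> _) set)"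
    by (simp add: card_image)
  then show ?case
    using insert.IH[OF B(1)] insert.hyps by (simp add: card_cartesian_product)
qed

lemma card_subspace:
  fixes S :: "('a::{field, finite} ^ 'n::finite) set"
  assumes "vec.subspace S"
  shows "card S = CARD('a) ^ vec.dim S"
proof -
  obtain B where B: "B \<subseteq> S" "vec.independent B" "S \<subseteq> vec.span B" "card B = vec.dim S"
    using vec.basis_exists by blast
  have "vec.span B = S"
    using B assms vec.span_minimal by blast
  then show ?thesis
    using card_span_independent[of B] B by simp
qed

lemma dim_adjoin:
  assumes "vec.subspace S" "v \<notin> S"
  shows "vec.dim (vec.span (insert v S)) = Suc (vec.dim S)"
  using assms by (simp add: vec.dim_insert vec.span_eq_iff[THEN iffD2])

lemma adjoin_unique:
  assumes "vec.subspace S" "vec.subspace Z" "S \<subseteq> Z" "v \<in> Z" "v \<notin> S" "vec.dim Z = Suc (vec.dim S)"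
  shows "Z = vec.span (insert v S)"
proof -
  have "vec.span (insert v S) \<subseteq> Z"
    using assms by (intro vec.span_minimal) auto
  then have "vec.span (insert v S) = Z"
    using assms dim_adjoin[of S v] by (intro vec.subspace_dim_equal) auto
  then show ?thesis ..
qed

lemma dim_span_Un:
  assumes "vec.subspace S" "vec.subspace T"
  shows "vec.dim (vec.span (S \<union> T)) + vec.dim (S \<inter> T) = vec.dim S + vec.dim T"
proof -
  have "vec.span (S \<union> T) = {x + y |x y. x \<in> S \<and> y \<in> T}"
    using assms unfolding vec.span_Un by (simp add: vec.span_eq_iff[THEN iffD2])
  then show ?thesis
    using vec.dim_sums_Int[OF assms] by simp
qed

text \<open>Inside \<open>Y\<close> the sum of \<open>X \<inter> Y\<close> and \<open>U\<close>
  exceeds \<open>U\<close> by at most one dimension, and the two meet in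
  \<open>X \<inter> U\<close>; the dimension formula does the rest.\<close>

lemma dim_inter_le_one_dimensional_extension:
  assumes "vec.subspace X" "vec.subspace U" "vec.subspace Y" "U \<subseteq> Y" "vec.dim Y \<le> Suc (vec.dim U)"
  shows "vec.dim (X \<inter> Y) \<le> Suc (vec.dim (X \<inter> U))"
proof -
  have "vec.dim (vec.span (X \<inter> Y \<union> U)) \<le> vec.dim Y"
    using assms vec.dim_subset[of "vec.span (X \<inter> Y \<union> U)" Y]
      vec.span_minimal[of "X \<inter> Y \<union> U" Y] by auto
  moreover have "X \<inter> Y \<inter> U = X \<inter> U"
    using assms by auto
  ultimately show ?thesis
    using dim_span_Un[of "X \<inter> Y" U] assms by (simp add: vec.subspace_inter)
qed

definition subspaces_between ::
    "('a::field ^ 'n) set \<Rightarrow> ('a ^ 'n) set \<Rightarrow> nat \<Rightarrow> ('a ^ 'n) set set" where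
  "subspaces_between U W k = {Z. vec.subspace Z \<and> U \<subseteq> Z \<and> Z \<subseteq> W \<and> vec.dim Z = k}"

text \<open>Every vector of \<open>W - U\<close> lies in exactly one extension, the one it spans
  with \<open>U\<close>, so the sets \<open>Z - U\<close> partition \<open>W - U\<close> into blocks
  of equal size.\<close>

lemma card_subspaces_above:
  fixes U W :: "('a::{field, finite} ^ 'n::finite) set"
  assumes U: "vec.subspace U" and W: "vec.subspace W" and UW: "U \<subseteq> W"
  shows "card (subspaces_between U W (Suc (vec.dim U))) = q_int CARD('a) (vec.dim W - vec.dim U)"
proof -
  let ?q = "CARD('a)" and ?u = "vec.dim U" and ?w = "vec.dim W"
  let ?N = "subspaces_between U W (Suc (vec.dim U))"
  have q: "2 \<le> ?q"
    by (rule card_field_ge_2)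
  have uw: "?u \<le> ?w"
    using UW by (rule vec.dim_subset)
  have "W - U = (\<Union>Z\<in>?N. Z - U)"
  proof (intro equalityI subsetI)
    fix v assume v: "v \<in> W - U"
    have "vec.span (insert v U) \<in> ?N"
      using v U W UW dim_adjoin[of U v] vec.span_minimal[of "insert v U" W]
      by (auto simp: subspaces_between_def intro: vec.span_base)
    moreover have "v \<in> vec.span (insert v U)"
      by (simp add: vec.span_base)
    ultimately show "v \<in> (\<Union>Z\<in>?N. Z - U)"
      using v by blast
  qed (auto simp: subspaces_between_def)
  then have "card (W - U) = (\<Sum>Z\<in>?N. card (Z - U))"
  proof (simp only:, intro card_UN_disjoint ballI impI)
    fix Z Z' assume Z: "Z \<in> ?N" "Z' \<in> ?N" "Z \<noteq> Z'"
    show "(Z - U) \<inter> (Z' - U) = {}"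
    proof (rule ccontr)
      assume "(Z - U) \<inter> (Z' - U) \<noteq> {}"
      then obtain v where "v \<in> Z" "v \<in> Z'" "v \<notin> U"
        by blast
      then show False
        using Z adjoin_unique[of U Z v] adjoin_unique[of U Z' v] U
        by (auto simp: subspaces_between_def)
    qed
  qed auto
  also have "\<dots> = (\<Sum>Z\<in>?N. ?q ^ Suc ?u - ?q ^ ?u)"
  proof (rule sum.cong)
    fix Z assume "Z \<in> ?N"
    then show "card (Z - U) = ?q ^ Suc ?u - ?q ^ ?u"
      using card_subspace[of Z] card_subspace[of U] U
      by (simp add: subspaces_between_def card_Diff_subset)
  qed simp
  also have "\<dots> = card ?N * ((?q - 1) * ?q ^ ?u)"
    by (simp add: diff_mult_distrib)
  finally have "?q ^ ?w - ?q ^ ?u = card ?N * ((?q - 1) * ?q ^ ?u)"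
    using U W UW by (simp add: card_Diff_subset card_subspace)
  moreover have "?q ^ ?w - ?q ^ ?u = (?q ^ (?w - ?u) - 1) * ?q ^ ?u"
    using uw by (simp add: diff_mult_distrib flip: power_add)
  moreover have "?q ^ (?w - ?u) - 1 = (?q - 1) * q_int ?q (?w - ?u)"
    using q by (subst q_int_mult) auto
  ultimately have eq: "card ?N * ((?q - 1) * ?q ^ ?u) = q_int ?q (?w - ?u) * ((?q - 1) * ?q ^ ?u)"
    by (simp add: mult_ac)
  have "(?q - 1) * ?q ^ ?u \<noteq> 0"
    using q by simp
  then show ?thesis
    using eq by (rule mult_right_cancel[THEN iffD1])
qed

section \<open>Nondegenerate symmetric bilinear forms\<close>

text \<open>Nondegeneracy is asked on \<open>V\<close> alone, so that a hyperbolic space can sit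
  inside a larger coordinate space. The locale serves for the dot product, as a duality of the
  subspace lattice, and for the polar form of a quadratic form.\<close>

locale nondegenerate_form =
  fixes B :: "'a::field ^ 'n::finite \<Rightarrow> 'a ^ 'n \<Rightarrow> 'a" and V :: "('a ^ 'n) set"
  assumes subspace_V: "vec.subspace V"
    and sym: "B x y = B y x"
    and add_left: "B (x + y) z = B x z + B y z"
    and scale_left: "B (c *s x) y = c * B x y"
    and nondegenerate: "w \<in> V \<Longrightarrow> (\<And>u. u \<in> V \<Longrightarrow> B u w = 0) \<Longrightarrow> w = 0"
begin

lemma add_right: "B x (y + z) = B x y + B x z"
  using add_left sym by metis

lemma scale_right: "B x (c *s y) = c * B x y"
  using scale_left sym by metis

lemma zero_left [simp]: "B 0 y = 0" and zero_right [simp]: "B y 0 = 0"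
  using scale_left[of 0 0 y] scale_right[of y 0 0] by simp_all

lemma diff_right: "B x (y - z) = B x y - B x z"
  using add_right[of x "y - z" z] by simp

definition perp :: "('a ^ 'n) set \<Rightarrow> ('a ^ 'n) set" where
  "perp U = {w \<in> V. \<forall>u\<in>U. B u w = 0}"

lemma perp_subset: "perp U \<subseteq> V"
  by (auto simp: perp_def)

lemma perp_antimono: "U \<subseteq> W \<Longrightarrow> perp W \<subseteq> perp U"
  by (auto simp: perp_def)

lemma perp_empty [simp]: "perp {} = V"
  by (simp add: perp_def)

lemma subspace_perp: "vec.subspace (perp U)"
  using subspace_V by (auto simp: perp_def vec.subspace_def add_right scale_right)

lemma perp_Un: "perp (U \<union> W) = perp U \<inter> perp W"
  by (auto simp: perp_def)

lemma perp_span: "perp (vec.span U) = perp U"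
proof (intro equalityI subsetI)
  fix w assume w: "w \<in> perp U"
  have "vec.subspace {u. B u w = 0}"
    by (auto simp: vec.subspace_def add_left scale_left)
  then have "vec.span U \<subseteq> {u. B u w = 0}"
    using w by (intro vec.span_minimal) (auto simp: perp_def)
  then show "w \<in> perp (vec.span U)"
    using w by (auto simp: perp_def)
qed (use perp_antimono[OF vec.span_superset] in blast)

text \<open>A vector \<open>w0\<close> with \<open>B v w0 \<noteq> 0\<close> corrects every
  \<open>w\<close> into the kernel, so one linear condition costs at most one dimension.\<close>

lemma dim_functional_kernel:
  assumes W: "vec.subspace W"
  shows "vec.dim W \<le> Suc (vec.dim {w \<in> W. B v w = 0})"
proof (cases "\<exists>w\<in>W. B v w \<noteq> 0")
  case True
  then obtain w0 where w0: "w0 \<in> W" "B v w0 \<noteq> 0"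
    by blast
  let ?K = "{w \<in> W. B v w = 0}"
  have "W \<subseteq> vec.span (insert w0 ?K)"
  proof
    fix w assume "w \<in> W"
    then have "w - (B v w / B v w0) *s w0 \<in> ?K"
      using w0 W by (auto simp: diff_right scale_right intro: vec.subspace_diff vec.subspace_scale)
    then show "w \<in> vec.span (insert w0 ?K)"
      unfolding vec.span_breakdown_eq by (intro exI) (rule vec.span_base)
  qed
  then have "vec.dim W \<le> vec.dim (insert w0 ?K)"
    by (rule vec.dim_mono)
  also have "\<dots> \<le> Suc (vec.dim ?K)"
    by (simp add: vec.dim_insert)
  finally show ?thesis .
next
  case False
  then have "{w \<in> W. B v w = 0} = W"
    by auto
  then show ?thesis
    by simp
qed

lemma dim_perp_Un_finite:
  assumes "finite C"
  shows "vec.dim (perp U) \<le> vec.dim (perp (U \<union> C)) + card C"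
  using assms
proof (induction C)
  case (insert c C)
  have "perp (U \<union> insert c C) = {w \<in> perp (U \<union> C). B c w = 0}"
    by (auto simp: perp_def)
  then show ?case
    using insert dim_functional_kernel[OF subspace_perp, of "U \<union> C" c] by simp
qed simp

text \<open>Each imposed vector costs at most one dimension, which yields both inequalities: pass
  from no condition to a basis \<open>C\<close> of \<open>U\<close>, and from \<open>C\<close> to a
  basis \<open>D\<close> of \<open>V\<close>, where only zero is left.\<close>

lemma dim_perp:
  assumes U: "vec.subspace U" "U \<subseteq> V"
  shows "vec.dim (perp U) + vec.dim U = vec.dim V"
proof (rule antisym)
  obtain C where C: "C \<subseteq> U" "vec.independent C" "U \<subseteq> vec.span C" "card C = vec.dim U"
    using vec.basis_exists by blast
  have "finite C"
    using C vec.finiteI_independent by blast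
  have span_C: "vec.span C = U"
    using C U vec.span_minimal by blast
  show "vec.dim V \<le> vec.dim (perp U) + vec.dim U"
    using dim_perp_Un_finite[OF \<open>finite C\<close>, of "{}"] C perp_span[of C] span_C by simp
  obtain D where D: "C \<subseteq> D" "D \<subseteq> V" "vec.independent D" "V \<subseteq> vec.span D"
    using vec.maximal_independent_subset_extend[of C V] C U by blast
  have "finite D"
    using D vec.finiteI_independent by blast
  have "vec.span D = V"
    using D subspace_V vec.span_minimal by blast
  then have "perp D = perp V"
    using perp_span[of D] by simp
  also have "perp V = {0}"
    using nondegenerate vec.subspace_0[OF subspace_V] by (auto simp: perp_def)
  finally have "vec.dim (perp C) \<le> card (D - C)"
    using dim_perp_Un_finite[of "D - C" C] \<open>finite D\<close> D by (simp add: Un_absorb1)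
  also have "\<dots> = vec.dim V - vec.dim U"
    using D C \<open>finite C\<close> vec.dim_eq_card[of D V] \<open>vec.span D = V\<close>
    by (simp add: card_Diff_subset vec.span_eq_iff[THEN iffD2] subspace_V)
  finally show "vec.dim (perp U) + vec.dim U \<le> vec.dim V"
    using perp_span[of C] span_C vec.dim_subset[OF U(2)] by simp
qed

lemma perp_perp:
  assumes U: "vec.subspace U" "U \<subseteq> V"
  shows "perp (perp U) = U"
proof -
  have "U \<subseteq> perp (perp U)"
    using U(2) sym by (auto simp: perp_def)
  moreover have "vec.dim (perp (perp U)) \<le> vec.dim U"
    using dim_perp[OF U] dim_perp[OF subspace_perp perp_subset, of U] by simp
  ultimately show ?thesis
    using vec.subspace_dim_equal[OF U(1) subspace_perp] by blast
qed

end

interpretation dot_form: nondegenerate_form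
  "\<lambda>x y :: 'a::field ^ 'n::finite. \<Sum>i\<in>UNIV. x $ i * y $ i" UNIV
proof
  fix w :: "'a ^ 'n"
  assume w: "\<And>u. u \<in> UNIV \<Longrightarrow> (\<Sum>i\<in>UNIV. u $ i * w $ i) = 0"
  have "w $ j = 0" for j
    using w[of "axis j 1"] by (simp add: axis_def if_distrib[of "\<lambda>x. x * _"] cong: if_cong)
  then show "w = 0"
    by (simp add: vec_eq_iff)
next
  fix x y :: "'a ^ 'n"
  show "(\<Sum>i\<in>UNIV. x $ i * y $ i) = (\<Sum>i\<in>UNIV. y $ i * x $ i)"
    by (simp add: mult.commute)
next
  fix x y z :: "'a ^ 'n" and c :: 'a
  show "(\<Sum>i\<in>UNIV. (x + y) $ i * z $ i) = (\<Sum>i\<in>UNIV. x $ i * z $ i) + (\<Sum>i\<in>UNIV. y $ i * z $ i)"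
    by (simp add: sum.distrib distrib_right)
  show "(\<Sum>i\<in>UNIV. (c *s x) $ i * y $ i) = c * (\<Sum>i\<in>UNIV. x $ i * y $ i)"
    by (simp add: sum_distrib_left mult.assoc)
qed simp

text \<open>Orthogonal complements turn hyperplanes of \<open>W\<close> into one-dimensional extensions.\<close>

lemma card_hyperplanes_above:
  fixes U W :: "('a::{field, finite} ^ 'n::finite) set"
  assumes U: "vec.subspace U" and W: "vec.subspace W" and UW: "U \<subseteq> W" and k: "Suc k = vec.dim W"
  shows "card (subspaces_between U W k) = q_int CARD('a) (vec.dim W - vec.dim U)"
proof -
  let ?p = "dot_form.perp :: ('a ^ 'n) set \<Rightarrow> _"
  let ?m = "Suc (vec.dim (?p W))"
  have pp: "?p (?p Z) = Z" if "vec.subspace Z" for Z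
    using dot_form.perp_perp[OF that] by simp
  have dp: "vec.dim (?p Z) + vec.dim Z = CARD('n)" if "vec.subspace Z" for Z
    using dot_form.dim_perp[OF that] by (simp add: vec.dim_UNIV card_cart_basis)
  have sp: "vec.subspace (?p Z)" for Z
    by (rule dot_form.subspace_perp)
  have "bij_betw ?p (subspaces_between U W k) (subspaces_between (?p W) (?p U) ?m)"
  proof (rule bij_betw_byWitness[where f' = ?p])
    show "\<forall>Z\<in>subspaces_between U W k. ?p (?p Z) = Z"
      by (auto simp: subspaces_between_def pp)
    show "\<forall>Z\<in>subspaces_between (?p W) (?p U) ?m. ?p (?p Z) = Z"
      by (auto simp: subspaces_between_def pp)
    have "?p Z \<in> subspaces_between (?p W) (?p U) ?m" if "Z \<in> subspaces_between U W k" for Z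
      using that dp[of Z] dp[of W] W k dot_form.perp_antimono[of U Z] dot_form.perp_antimono[of Z W]
      unfolding subspaces_between_def by (simp add: sp)
    then show "?p ` subspaces_between U W k \<subseteq> subspaces_between (?p W) (?p U) ?m"
      by blast
    have "?p Z \<in> subspaces_between U W k" if "Z \<in> subspaces_between (?p W) (?p U) ?m" for Z
      using that dp[of Z] dp[of W] W U k pp
        dot_form.perp_antimono[of "?p W" Z] dot_form.perp_antimono[of Z "?p U"]
      unfolding subspaces_between_def by (simp add: sp)
    then show "?p ` subspaces_between (?p W) (?p U) ?m \<subseteq> subspaces_between U W k"
      by blast
  qed
  then have "card (subspaces_between U W k) = card (subspaces_between (?p W) (?p U) ?m)"
    by (rule bij_betw_same_card)
  also have "\<dots> = q_int CARD('a) (vec.dim (?p U) - vec.dim (?p W))"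
    using UW by (intro card_subspaces_above sp dot_form.perp_antimono)
  also have "vec.dim (?p U) - vec.dim (?p W) = vec.dim W - vec.dim U"
    using dp[OF U] dp[OF W] by linarith
  finally show ?thesis .
qed

lemma subspaces_between_top:
  "vec.subspace W \<Longrightarrow> U \<subseteq> W \<Longrightarrow> subspaces_between U W (vec.dim W) = {W}"
  using vec.subspace_dim_equal[of _ W] by (fastforce simp: subspaces_between_def)

section \<open>Gaussian binomials and the q-binomial theorem\<close>

lemma gauss_binomial_0 [simp]: "gauss_binomial q n 0 = 1"
  by (simp add: gauss_binomial_def)

lemma gauss_binomial_Suc_right:
  "gauss_binomial q n (Suc j) =
     gauss_binomial q n j * ((real q ^ (n - j) - 1) / (real q ^ Suc j - 1))"
  by (simp add: gauss_binomial_def)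

lemma gauss_binomial_eq_0: "n < j \<Longrightarrow> gauss_binomial q n j = 0"
  unfolding gauss_binomial_def by (rule prod_zero) (auto intro!: bexI[of _ n])

lemma gauss_binomial_Suc_Suc:
  "gauss_binomial q (Suc n) (Suc j) =
     gauss_binomial q n j * ((real q ^ Suc n - 1) / (real q ^ Suc j - 1))"
proof -
  have "(\<Prod>i<Suc j. real q ^ (Suc n - i) - 1) = (real q ^ Suc n - 1) * (\<Prod>i<j. real q ^ (n - i) - 1)"
    by (subst prod.lessThan_Suc_shift) simp
  then show ?thesis
    by (simp add: gauss_binomial_def prod_dividef)
qed

lemma power_minus_1_neq_0: "2 \<le> q \<Longrightarrow> 0 < m \<Longrightarrow> real q ^ m - 1 \<noteq> 0"
  using power_inject_exp[of "real q" m 0] by auto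

text \<open>By absorption all three terms are multiples of \<open>gauss_binomial q n j\<close>, and
  the identity reduces to a splitting of \<open>q ^ Suc n - 1\<close>.\<close>

lemma gauss_binomial_pascal:
  assumes "2 \<le> q" "j \<le> n"
  shows "gauss_binomial q (Suc n) (Suc j) =
     gauss_binomial q n (Suc j) + real q ^ (n - j) * gauss_binomial q n j"
proof -
  have "real q ^ Suc n - 1 = (real q ^ (n - j) - 1) + real q ^ (n - j) * (real q ^ Suc j - 1)"
    using assms(2) by (simp add: algebra_simps flip: power_add power_Suc)
  then have "(real q ^ Suc n - 1) / (real q ^ Suc j - 1) =
      (real q ^ (n - j) - 1) / (real q ^ Suc j - 1) + real q ^ (n - j)"
    using power_minus_1_neq_0[OF assms(1), of "Suc j"]
    by (simp only: add_divide_distrib) simp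
  then show ?thesis
    unfolding gauss_binomial_Suc_Suc gauss_binomial_Suc_right[of q n j]
    by (simp add: algebra_simps)
qed

lemma Suc_choose_2: "Suc j choose 2 = (j choose 2) + j"
  and zero_choose_2 [simp]: "0 choose 2 = 0"
  by (simp_all add: numeral_2_eq_2)

text \<open>Induction on \<open>n\<close> by Pascal's rule. The value \<open>t = 1\<close> gives the
  size of a minimum bitrade and the w.d. bound, \<open>t = -1\<close> the Moebius inversion.\<close>

theorem q_binomial_theorem:
  assumes "2 \<le> q"
  shows "(\<Prod>l<n. 1 + t * real q ^ l) =
    (\<Sum>j\<le>n. real q ^ (j choose 2) * gauss_binomial q n j * t ^ j)"
proof (induction n)
  case (Suc n)
  define A where "A = (\<lambda>m j. real q ^ (j choose 2) * gauss_binomial q m j * t ^ j)"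
  have step: "A (Suc n) (Suc j) = A n (Suc j) + t * real q ^ n * A n j" if "j \<le> n" for j
  proof -
    have "real q ^ (Suc j choose 2) * real q ^ (n - j) = real q ^ n * real q ^ (j choose 2)"
      using that by (simp add: Suc_choose_2 add.commute flip: power_add)
    then show ?thesis
      unfolding A_def gauss_binomial_pascal[OF assms that] by (simp add: algebra_simps)
  qed
  have "(\<Sum>j\<le>Suc n. A (Suc n) j) = A n 0 + (\<Sum>j\<le>n. A n (Suc j) + t * real q ^ n * A n j)"
    unfolding sum.atMost_Suc_shift using step by (simp add: A_def)
  also have "\<dots> = (\<Sum>j\<le>Suc n. A n j) + t * real q ^ n * (\<Sum>j\<le>n. A n j)"
    unfolding sum.atMost_Suc_shift by (simp add: sum.distrib sum_distrib_left)
  also have "(\<Sum>j\<le>Suc n. A n j) = (\<Sum>j\<le>n. A n j)"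
    by (simp add: A_def gauss_binomial_eq_0)
  also have "(\<Sum>j\<le>n. A n j) + t * real q ^ n * (\<Sum>j\<le>n. A n j) = (\<Prod>l<Suc n. 1 + t * real q ^ l)"
    using Suc by (simp add: A_def algebra_simps)
  finally show ?case
    by (simp add: A_def)
qed simp

section \<open>Levels of an interval of subspaces\<close>

text \<open>Induction on the codimension, by double counting nested pairs of codimensions
  \<open>j + 1\<close> and \<open>j\<close>: one side counts hyperplanes of the larger subspace, the
  other one-dimensional extensions of the smaller.\<close>

lemma card_subspaces_between:
  fixes U W :: "('a::{field, finite} ^ 'n::finite) set"
  assumes U: "vec.subspace U" and W: "vec.subspace W" and UW: "U \<subseteq> W"
    and j: "j \<le> vec.dim W - vec.dim U"
  shows "real (card (subspaces_between U W (vec.dim W - j))) =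
    gauss_binomial CARD('a) (vec.dim W - vec.dim U) j"
  using j
proof (induction j)
  case 0
  then show ?case
    using W UW by (simp add: subspaces_between_top)
next
  case (Suc j)
  let ?q = "CARD('a)" and ?u = "vec.dim U" and ?w = "vec.dim W"
  let ?M = "subspaces_between U W (?w - j)" and ?N = "subspaces_between U W (?w - Suc j)"
  have less: "Suc (?w - Suc j) = ?w - j" "j < ?w - ?u"
    using Suc.prems by auto
  have "(\<Sum>Z\<in>?N. card {Z' \<in> ?M. Z \<subseteq> Z'}) = (\<Sum>Z'\<in>?M. q_int ?q (?w - ?u - j))"
  proof (rule sum_multicount_gen; (intro ballI)?)
    fix Z' assume Z': "Z' \<in> ?M"
    have "{Z \<in> ?N. Z \<subseteq> Z'} = subspaces_between U Z' (?w - Suc j)"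
      using Z' by (auto simp: subspaces_between_def)
    also have "card \<dots> = q_int ?q (vec.dim Z' - ?u)"
      using Z' U less by (intro card_hyperplanes_above) (auto simp: subspaces_between_def)
    also have "vec.dim Z' - ?u = ?w - ?u - j"
      using Z' by (simp add: subspaces_between_def)
    finally show "card {Z \<in> ?N. Z \<subseteq> Z'} = q_int ?q (?w - ?u - j)" .
  qed auto
  also have "(\<Sum>Z\<in>?N. card {Z' \<in> ?M. Z \<subseteq> Z'}) = (\<Sum>Z\<in>?N. q_int ?q (Suc j))"
  proof (rule sum.cong)
    fix Z assume Z: "Z \<in> ?N"
    have "{Z' \<in> ?M. Z \<subseteq> Z'} = subspaces_between Z W (Suc (vec.dim Z))"
      using Z less by (auto simp: subspaces_between_def)
    also have "card \<dots> = q_int ?q (?w - vec.dim Z)"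
      using Z W by (intro card_subspaces_above) (auto simp: subspaces_between_def)
    also have "?w - vec.dim Z = Suc j"
      using Z less by (auto simp: subspaces_between_def)
    finally show "card {Z' \<in> ?M. Z \<subseteq> Z'} = q_int ?q (Suc j)" .
  qed simp
  finally have "card ?N * q_int ?q (Suc j) = card ?M * q_int ?q (?w - ?u - j)"
    by simp
  \<comment> \<open>Multiplying by \<open>q - 1\<close> turns the q-integers into the differences
    \<open>q ^ m - 1\<close> that occur in \<open>gauss_binomial\<close>.\<close>
  then have "real (card ?N) * real (q_int ?q (Suc j)) * (real ?q - 1) =
      real (card ?M) * real (q_int ?q (?w - ?u - j)) * (real ?q - 1)"
    by (simp only: flip: of_nat_mult)
  then have "real (card ?N) * (real ?q ^ Suc j - 1) = real (card ?M) * (real ?q ^ (?w - ?u - j) - 1)"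
    by (simp only: mult.assoc q_int_mult_real)
  moreover have "real ?q ^ Suc j - 1 \<noteq> 0"
    using card_field_ge_2 by (rule power_minus_1_neq_0) simp
  ultimately have "real (card ?N) = real (card ?M) * ((real ?q ^ (?w - ?u - j) - 1) / (real ?q ^ Suc j - 1))"
    by (simp add: field_simps)
  then show ?case
    using Suc by (simp add: gauss_binomial_Suc_right)
qed

lemma sum_over_intermediate_subspaces:
  fixes U W :: "('a::{field, finite} ^ 'n::finite) set" and \<phi> :: "nat \<Rightarrow> real"
  assumes U: "vec.subspace U" and W: "vec.subspace W" and UW: "U \<subseteq> W"
  shows "(\<Sum>Z | vec.subspace Z \<and> U \<subseteq> Z \<and> Z \<subseteq> W. \<phi> (vec.dim W - vec.dim Z)) =
    (\<Sum>j\<le>vec.dim W - vec.dim U. gauss_binomial CARD('a) (vec.dim W - vec.dim U) j * \<phi> j)"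
proof -
  let ?P = "{Z. vec.subspace Z \<and> U \<subseteq> Z \<and> Z \<subseteq> W}" and ?n = "vec.dim W - vec.dim U"
  have "(\<Sum>Z\<in>?P. \<phi> (vec.dim W - vec.dim Z)) =
      (\<Sum>j\<le>?n. \<Sum>Z | Z \<in> ?P \<and> vec.dim W - vec.dim Z = j. \<phi> (vec.dim W - vec.dim Z))"
    by (rule sum.group[symmetric]) (auto intro!: diff_le_mono2 vec.dim_subset)
  also have "\<dots> = (\<Sum>j\<le>?n. gauss_binomial CARD('a) ?n j * \<phi> j)"
  proof (rule sum.cong)
    fix j assume j: "j \<in> {..?n}"
    have "{Z. Z \<in> ?P \<and> vec.dim W - vec.dim Z = j} = subspaces_between U W (vec.dim W - j)"
      using j vec.dim_subset[of _ W] by (fastforce simp: subspaces_between_def)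
    moreover have "(\<Sum>Z | Z \<in> ?P \<and> vec.dim W - vec.dim Z = j. \<phi> (vec.dim W - vec.dim Z)) =
        (\<Sum>Z | Z \<in> ?P \<and> vec.dim W - vec.dim Z = j. \<phi> j)"
      by (intro sum.cong) auto
    ultimately show "(\<Sum>Z | Z \<in> ?P \<and> vec.dim W - vec.dim Z = j. \<phi> (vec.dim W - vec.dim Z)) =
        gauss_binomial CARD('a) ?n j * \<phi> j"
      using j card_subspaces_between[OF U W UW, of j] by simp
  qed simp
  finally show ?thesis .
qed

text \<open>At \<open>t = -1\<close> the factor \<open>l = 0\<close> of the product
  vanishes.\<close>

lemma q_binomial_alternating:
  assumes "2 \<le> q" "0 < n"
  shows "(\<Sum>j\<le>n. gauss_binomial q n j * ((- 1) ^ j * real q ^ (j choose 2))) = 0"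
proof -
  have "(\<Prod>l<n. 1 + - 1 * real q ^ l) = 0"
    using assms(2) by (intro prod_zero) (auto intro!: bexI[of _ 0])
  then show ?thesis
    unfolding q_binomial_theorem[OF assms(1)] by (simp add: mult_ac)
qed


section \<open>Null designs\<close>

text \<open>Double counting over the \<open>(d - 1)\<close>-subspaces above \<open>U\<close>: each
  \<open>d\<close>-subspace above \<open>U\<close> is met
  \<open>q_int CARD('a) (d - vec.dim U)\<close> times, and this factor is positive.\<close>

lemma null_design_above:
  fixes f :: "('a::{field, finite} ^ 'n::finite) set \<Rightarrow> real"
  assumes null: "\<And>U. U \<in> subspaces_of_dim (d - 1) \<Longrightarrow> (\<Sum>Y | Y \<in> subspaces_of_dim d \<and> U \<subseteq> Y. f Y) = 0"
    and U: "vec.subspace U" "vec.dim U < d"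
  shows "(\<Sum>Y | Y \<in> subspaces_of_dim d \<and> U \<subseteq> Y. f Y) = 0"
proof -
  let ?S = "subspaces_of_dim d :: ('a ^ 'n) set set"
  let ?H = "{U' \<in> subspaces_of_dim (d - 1). U \<subseteq> U'}"
  have "0 = (\<Sum>U'\<in>?H. \<Sum>Y | Y \<in> ?S \<and> U' \<subseteq> Y. f Y)"
    using null by simp
  also have "\<dots> = (\<Sum>Y\<in>?S. \<Sum>U' | U' \<in> ?H \<and> U' \<subseteq> Y. f Y)"
    by (rule sum.swap_restrict) auto
  also have "\<dots> = (\<Sum>Y\<in>?S. if U \<subseteq> Y then real (q_int CARD('a) (d - vec.dim U)) * f Y else 0)"
  proof (rule sum.cong)
    fix Y assume Y: "Y \<in> ?S"
    have "{U'. U' \<in> ?H \<and> U' \<subseteq> Y} = subspaces_between U Y (d - 1)"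
      by (auto simp: subspaces_between_def subspaces_of_dim_def)
    moreover have "card (subspaces_between U Y (d - 1)) = q_int CARD('a) (d - vec.dim U)" if "U \<subseteq> Y"
      using that Y U card_hyperplanes_above[of U Y "d - 1"] by (auto simp: subspaces_of_dim_def)
    moreover have "subspaces_between U Y (d - 1) = {}" if "\<not> U \<subseteq> Y"
      using that by (auto simp: subspaces_between_def)
    ultimately show "(\<Sum>U' | U' \<in> ?H \<and> U' \<subseteq> Y. f Y) =
        (if U \<subseteq> Y then real (q_int CARD('a) (d - vec.dim U)) * f Y else 0)"
      by simp
  qed simp
  also have "\<dots> = real (q_int CARD('a) (d - vec.dim U)) * (\<Sum>Y | Y \<in> ?S \<and> U \<subseteq> Y. f Y)"
    by (simp add: sum_distrib_left sum.inter_filter if_distrib[of "\<lambda>z. _ * z"] cong: if_cong)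
  finally show ?thesis
    using q_int_pos[of "d - vec.dim U" "CARD('a)"] U(2) by simp
qed

text \<open>
  Moebius inversion on the lattice of subspaces of \<open>x\<close>; the alternating \<open>q\<close>-binomial sum
  supplies the values of the Moebius function.
\<close>

lemma null_design_sphere:
  fixes f :: "('a::{field, finite} ^ 'n::finite) set \<Rightarrow> real"
  assumes null: "\<And>U. U \<in> subspaces_of_dim (d - 1) \<Longrightarrow> (\<Sum>Y | Y \<in> subspaces_of_dim d \<and> U \<subseteq> Y. f Y) = 0"
    and x: "x \<in> subspaces_of_dim d" and U: "vec.subspace U" "U \<subseteq> x"
  shows "(\<Sum>Y | Y \<in> subspaces_of_dim d \<and> Y \<inter> x = U. f Y) =
    (- 1) ^ (d - vec.dim U) * real CARD('a) ^ ((d - vec.dim U) choose 2) * f x"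
  using U
proof (induction "d - vec.dim U" arbitrary: U rule: less_induct)
  case less
  let ?S = "subspaces_of_dim d :: ('a ^ 'n) set set"
  have x': "vec.subspace x" "vec.dim x = d"
    using x by (auto simp: subspaces_of_dim_def)
  define h where "h = (\<lambda>V. \<Sum>Y | Y \<in> ?S \<and> Y \<inter> x = V. f Y)"
  define \<mu> where "\<mu> = (\<lambda>j. (- 1) ^ j * real CARD('a) ^ (j choose 2))"
  have U_le: "vec.dim U \<le> d"
    using less.prems x' vec.dim_subset by blast
  have "h U = \<mu> (d - vec.dim U) * f x"
  proof (cases "vec.dim U = d")
    case True
    then have "U = x"
      using less.prems x' vec.subspace_dim_equal[of U x] by simp
    moreover have "{Y. Y \<in> ?S \<and> Y \<inter> x = x} = {x}"
    proof -
      have "Y = x" if "Y \<in> ?S" "Y \<inter> x = x" for Y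
        using that x' vec.subspace_dim_equal[of x Y] by (auto simp: subspaces_of_dim_def)
      then show ?thesis
        using x by auto
    qed
    ultimately show ?thesis
      using True by (simp add: h_def \<mu>_def)
  next
    case False
    let ?n = "d - vec.dim U" and ?P = "{V. vec.subspace V \<and> U \<subseteq> V \<and> V \<subseteq> x}"
    have "0 = (\<Sum>Y | Y \<in> ?S \<and> U \<subseteq> Y. f Y)"
      using null_design_above[OF null less.prems(1)] False U_le by simp
    also have "\<dots> = (\<Sum>V\<in>?P. \<Sum>Y | Y \<in> {Y. Y \<in> ?S \<and> U \<subseteq> Y} \<and> Y \<inter> x = V. f Y)"
      using less.prems x'
      by (intro sum.group[symmetric]) (auto simp: subspaces_of_dim_def intro: vec.subspace_inter)
    also have "\<dots> = (\<Sum>V\<in>?P. h V)"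
      unfolding h_def by (intro sum.cong) auto
    also have "\<dots> = h U + (\<Sum>V\<in>?P - {U}. h V)"
      using less.prems by (intro sum.remove) auto
    \<comment> \<open>Each \<open>V\<close> strictly above \<open>U\<close> has smaller codimension
      in \<open>x\<close>, so the induction hypothesis supplies \<open>h V\<close>.\<close>
    also have "(\<Sum>V\<in>?P - {U}. h V) = (\<Sum>V\<in>?P - {U}. \<mu> (d - vec.dim V) * f x)"
    proof (intro sum.cong refl)
      fix V assume V: "V \<in> ?P - {U}"
      then have "\<not> vec.dim V \<le> vec.dim U"
        using vec.subspace_dim_equal[OF less.prems(1), of V] by auto
      moreover have "vec.dim V \<le> d"
        using V x' vec.dim_subset by blast
      ultimately show "h V = \<mu> (d - vec.dim V) * f x"
        using less.hyps[of V] V unfolding h_def \<mu>_def by simp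
    qed
    \<comment> \<open>Adding the missing term at \<open>U\<close> completes the sum to the whole
      interval from \<open>U\<close> to \<open>x\<close>, where it vanishes; the term subtracted
      again is the value claimed for \<open>h U\<close>.\<close>
    also have "\<dots> = (\<Sum>V\<in>?P. \<mu> (d - vec.dim V) * f x) - \<mu> ?n * f x"
      using less.prems by (subst sum_diff1) auto
    also have "(\<Sum>V\<in>?P. \<mu> (d - vec.dim V) * f x) = (\<Sum>V\<in>?P. \<mu> (vec.dim x - vec.dim V)) * f x"
      by (simp add: x' sum_distrib_right)
    also have "(\<Sum>V\<in>?P. \<mu> (vec.dim x - vec.dim V)) = (\<Sum>j\<le>?n. gauss_binomial CARD('a) ?n j * \<mu> j)"
      using sum_over_intermediate_subspaces[OF less.prems(1) x'(1) less.prems(2), of \<mu>] x' by simp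
    also have "\<dots> = 0"
      unfolding \<mu>_def using False U_le card_field_ge_2 by (intro q_binomial_alternating) auto
    finally show ?thesis
      by simp
  qed
  then show ?case
    by (simp add: h_def \<mu>_def)
qed


section \<open>Spheres in a bitrade\<close>

definition bitrade_sign :: "'b set \<Rightarrow> 'b set \<Rightarrow> 'b \<Rightarrow> real" where
  "bitrade_sign T0 T1 Y = of_bool (Y \<in> T0) - of_bool (Y \<in> T1)"

lemma bitrade_sign_eq_0: "Y \<notin> T0 \<union> T1 \<Longrightarrow> bitrade_sign T0 T1 Y = 0"
  by (auto simp: bitrade_sign_def)

lemma abs_bitrade_sign:
  "steiner_bitrade d T0 T1 \<Longrightarrow> Y \<in> T0 \<union> T1 \<Longrightarrow> \<bar>bitrade_sign T0 T1 Y\<bar> = 1"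
  by (auto simp: bitrade_sign_def steiner_bitrade_def)

text \<open>Both alternatives of the clique condition give equal cardinalities, and this is all that
  the lower bound retains of that condition.\<close>

lemma bitrade_sign_null:
  fixes T0 T1 :: "('a::{field, finite} ^ 'n::finite) set set"
  assumes T: "steiner_bitrade d T0 T1" and U: "U \<in> subspaces_of_dim (d - 1)"
  shows "(\<Sum>Y | Y \<in> subspaces_of_dim d \<and> U \<subseteq> Y. bitrade_sign T0 T1 Y) = 0"
proof -
  let ?C = "{Y \<in> subspaces_of_dim d. U \<subseteq> Y}"
  have "?C \<in> grassmann_cliques d"
    using U by (auto simp: grassmann_cliques_def)
  then have "card (?C \<inter> T0) = card (?C \<inter> T1)"
    using T by (auto simp: steiner_bitrade_def)
  moreover have "(\<Sum>Y\<in>?C. bitrade_sign T0 T1 Y) = real (card (?C \<inter> T0)) - real (card (?C \<inter> T1))"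
    by (simp add: bitrade_sign_def sum_subtractf Int_def)
  ultimately show ?thesis
    by simp
qed

lemma bitrade_sign_sphere:
  fixes T0 T1 :: "('a::{field, finite} ^ 'n::finite) set set"
  assumes T: "steiner_bitrade d T0 T1" and x: "x \<in> T0 \<union> T1" and V: "vec.subspace V" "V \<subseteq> x"
  shows "(\<Sum>Y | Y \<in> T0 \<union> T1 \<and> Y \<inter> x = V. bitrade_sign T0 T1 Y) =
    (- 1) ^ (d - vec.dim V) * real CARD('a) ^ ((d - vec.dim V) choose 2) * bitrade_sign T0 T1 x"
proof -
  have sub: "T0 \<union> T1 \<subseteq> subspaces_of_dim d"
    using T by (simp add: steiner_bitrade_def)
  have "(\<Sum>Y | Y \<in> T0 \<union> T1 \<and> Y \<inter> x = V. bitrade_sign T0 T1 Y) =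
      (\<Sum>Y | Y \<in> subspaces_of_dim d \<and> Y \<inter> x = V. bitrade_sign T0 T1 Y)"
    using sub by (intro sum.mono_neutral_left) (auto intro!: bitrade_sign_eq_0)
  then show ?thesis
    using null_design_sphere[OF bitrade_sign_null[OF T], of x V] x sub V by auto
qed

lemma bitrade_sphere_ge:
  fixes T0 T1 :: "('a::{field, finite} ^ 'n::finite) set set"
  assumes T: "steiner_bitrade d T0 T1" and x: "x \<in> T0 \<union> T1" and V: "vec.subspace V" "V \<subseteq> x"
  shows "real CARD('a) ^ ((d - vec.dim V) choose 2) \<le> real (card {Y \<in> T0 \<union> T1. Y \<inter> x = V})"
proof -
  let ?A = "{Y. Y \<in> T0 \<union> T1 \<and> Y \<inter> x = V}"
  have "real CARD('a) ^ ((d - vec.dim V) choose 2) = \<bar>\<Sum>Y\<in>?A. bitrade_sign T0 T1 Y\<bar>"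
    using bitrade_sign_sphere[OF assms] abs_bitrade_sign[OF T x] by (simp add: abs_mult power_abs)
  also have "\<dots> \<le> (\<Sum>Y\<in>?A. \<bar>bitrade_sign T0 T1 Y\<bar>)"
    by (rule sum_abs)
  also have "\<dots> = real (card ?A)"
    using abs_bitrade_sign[OF T] by simp
  finally show ?thesis
    by simp
qed

text \<open>The index set is the interval from \<open>{0}\<close> to \<open>x\<close>, the form to
  which \<open>sum_over_intermediate_subspaces\<close> applies.\<close>

lemma card_eq_sum_spheres:
  fixes x :: "('a::{field, finite} ^ 'n::finite) set"
  assumes T: "T \<subseteq> subspaces_of_dim d" and x: "vec.subspace x"
  shows "card T = (\<Sum>V | vec.subspace V \<and> {0} \<subseteq> V \<and> V \<subseteq> x. card {Y \<in> T. Y \<inter> x = V})"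
proof -
  have "(\<Sum>V | vec.subspace V \<and> {0} \<subseteq> V \<and> V \<subseteq> x. \<Sum>Y | Y \<in> T \<and> Y \<inter> x = V. 1 :: nat) = (\<Sum>Y\<in>T. 1)"
    using T x by (intro sum.group) (auto simp: subspaces_of_dim_def vec.subspace_inter vec.subspace_0)
  then show ?thesis
    by simp
qed

text \<open>Grouping by codimension turns the sum into the q-binomial expansion at
  \<open>t = 1\<close>.\<close>

lemma sum_choose_2_intermediate_subspaces:
  fixes x :: "('a::{field, finite} ^ 'n::finite) set"
  assumes "x \<in> subspaces_of_dim d"
  shows "(\<Sum>V | vec.subspace V \<and> {0} \<subseteq> V \<and> V \<subseteq> x. real CARD('a) ^ ((d - vec.dim V) choose 2)) =
    (\<Prod>l<d. 1 + real CARD('a) ^ l)"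
  using assms q_binomial_theorem[OF card_field_ge_2[where 'a = 'a], of 1 d]
    sum_over_intermediate_subspaces[of "{0}" x "\<lambda>j. real CARD('a) ^ (j choose 2)"]
  by (simp add: subspaces_of_dim_def vec.subspace_0 mult.commute)

lemma bitrade_card_ge:
  fixes T0 T1 :: "('a::{field, finite} ^ 'n::finite) set set"
  assumes T: "steiner_bitrade d T0 T1"
  shows "(\<Prod>l<d. 1 + real CARD('a) ^ l) \<le> real (card (T0 \<union> T1))"
proof -
  obtain x where x: "x \<in> T0 \<union> T1"
    using T by (auto simp: steiner_bitrade_def)
  have sub: "T0 \<union> T1 \<subseteq> subspaces_of_dim d"
    using T by (simp add: steiner_bitrade_def)
  then have x': "x \<in> subspaces_of_dim d" "vec.subspace x"
    using x by (auto simp: subspaces_of_dim_def)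
  show ?thesis
    unfolding card_eq_sum_spheres[OF sub x'(2)] sum_choose_2_intermediate_subspaces[OF x'(1), symmetric]
      of_nat_sum
    by (rule sum_mono) (use bitrade_sphere_ge[OF T x] in auto)
qed

text \<open>The total is the sum of the spheres over all subspaces of \<open>x\<close>; an excess in
  one of them would push it above the bound, since the others cannot fall below theirs.\<close>

lemma extremal_bitrade_sphere:
  fixes T0 T1 :: "('a::{field, finite} ^ 'n::finite) set set"
  assumes T: "steiner_bitrade d T0 T1" and x: "x \<in> T0 \<union> T1" and V: "vec.subspace V" "V \<subseteq> x"
    and min: "real (card (T0 \<union> T1)) = (\<Prod>l<d. 1 + real CARD('a) ^ l)"
  shows "card {Y \<in> T0 \<union> T1. Y \<inter> x = V} = CARD('a) ^ ((d - vec.dim V) choose 2)"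
proof (rule ccontr)
  assume neq: "card {Y \<in> T0 \<union> T1. Y \<inter> x = V} \<noteq> CARD('a) ^ ((d - vec.dim V) choose 2)"
  have sub: "T0 \<union> T1 \<subseteq> subspaces_of_dim d"
    using T by (simp add: steiner_bitrade_def)
  then have x': "x \<in> subspaces_of_dim d" "vec.subspace x"
    using x by (auto simp: subspaces_of_dim_def)
  have "V \<in> {V. vec.subspace V \<and> {0} \<subseteq> V \<and> V \<subseteq> x}"
    using V by (auto simp: vec.subspace_0)
  moreover have "real CARD('a) ^ ((d - vec.dim V) choose 2) < real (card {Y \<in> T0 \<union> T1. Y \<inter> x = V})"
    using bitrade_sphere_ge[OF T x V] neq by (simp flip: of_nat_power)
  ultimately have "(\<Sum>V | vec.subspace V \<and> {0} \<subseteq> V \<and> V \<subseteq> x. real CARD('a) ^ ((d - vec.dim V) choose 2)) <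
      (\<Sum>V | vec.subspace V \<and> {0} \<subseteq> V \<and> V \<subseteq> x. real (card {Y \<in> T0 \<union> T1. Y \<inter> x = V}))"
    by (intro sum_strict_mono_ex1) (use bitrade_sphere_ge[OF T x] in auto)
  then show False
    using card_eq_sum_spheres[OF sub x'(2)] sum_choose_2_intermediate_subspaces[OF x'(1)] min
    by simp
qed

text \<open>The sphere through \<open>y\<close> has as many members as the absolute value of its
  signed sum, so the triangle inequality is an equality and all its signs agree.\<close>

lemma extremal_bitrade_sign:
  fixes T0 T1 :: "('a::{field, finite} ^ 'n::finite) set set"
  assumes T: "steiner_bitrade d T0 T1" and x: "x \<in> T0 \<union> T1" and y: "y \<in> T0 \<union> T1"
    and min: "real (card (T0 \<union> T1)) = (\<Prod>l<d. 1 + real CARD('a) ^ l)"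
  shows "bitrade_sign T0 T1 y = (- 1) ^ (d - vec.dim (x \<inter> y)) * bitrade_sign T0 T1 x"
proof -
  define V where "V = y \<inter> x"
  define \<epsilon> where "\<epsilon> = (- 1) ^ (d - vec.dim V) * bitrade_sign T0 T1 x"
  let ?A = "{Y. Y \<in> T0 \<union> T1 \<and> Y \<inter> x = V}"
  have V: "vec.subspace V" "V \<subseteq> x"
    using T x y by (auto simp: V_def steiner_bitrade_def subspaces_of_dim_def intro!: vec.subspace_inter)
  have abs_\<epsilon>: "\<bar>\<epsilon>\<bar> = 1"
    using abs_bitrade_sign[OF T x] by (simp add: \<epsilon>_def abs_mult power_abs)
  then have \<epsilon>2: "\<epsilon> * \<epsilon> = 1"
    by (metis abs_mult_self_eq mult_1)
  \<comment> \<open>The summands are nonnegative because both factors have absolute value one; a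
    vanishing total then makes every sign equal to \<open>\<epsilon>\<close>.\<close>
  have "(\<Sum>Y\<in>?A. 1 - \<epsilon> * bitrade_sign T0 T1 Y) =
      real (card ?A) - \<epsilon> * (\<Sum>Y\<in>?A. bitrade_sign T0 T1 Y)"
    by (simp add: sum_subtractf sum_distrib_left)
  also have "\<dots> = real CARD('a) ^ ((d - vec.dim V) choose 2) * (1 - \<epsilon> * \<epsilon>)"
    using bitrade_sign_sphere[OF T x V] extremal_bitrade_sphere[OF T x V min]
    by (simp add: \<epsilon>_def algebra_simps)
  finally have "(\<Sum>Y\<in>?A. 1 - \<epsilon> * bitrade_sign T0 T1 Y) = 0"
    using \<epsilon>2 by simp
  moreover have "0 \<le> 1 - \<epsilon> * bitrade_sign T0 T1 Y" if "Y \<in> ?A" for Y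
  proof -
    have "\<bar>\<epsilon> * bitrade_sign T0 T1 Y\<bar> = 1"
      using abs_\<epsilon> abs_bitrade_sign[OF T, of Y] that by (simp add: abs_mult)
    then show ?thesis
      by linarith
  qed
  ultimately have "\<forall>Y\<in>?A. 1 - \<epsilon> * bitrade_sign T0 T1 Y = 0"
    by (subst (asm) sum_nonneg_eq_0_iff) auto
  then have "\<epsilon> * bitrade_sign T0 T1 y = 1"
    using y by (simp add: V_def)
  then have "bitrade_sign T0 T1 y = \<epsilon>"
    using \<epsilon>2 by (metis mult.assoc mult.left_neutral mult.right_neutral)
  then show ?thesis
    by (simp add: \<epsilon>_def V_def Int_commute)
qed


section \<open>Distances in induced subgraphs of the Grassmann graph\<close>

text \<open>\<open>y \<inter> z\<close> has codimension at most one in \<open>y\<close>, so moving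
  from \<open>y\<close> to \<open>z\<close> loses at most one dimension of the intersection with
  \<open>x\<close>. This bounds distances from below.\<close>

lemma dim_inter_le_adjacent:
  assumes "vec.subspace x" "y \<in> subspaces_of_dim d" "z \<in> subspaces_of_dim d" "vec.dim (y \<inter> z) = d - 1"
  shows "vec.dim (x \<inter> y) \<le> Suc (vec.dim (x \<inter> z))"
proof -
  have "vec.dim (x \<inter> y) \<le> Suc (vec.dim (x \<inter> (y \<inter> z)))"
    using assms by (intro dim_inter_le_one_dimensional_extension)
      (auto simp: subspaces_of_dim_def intro: vec.subspace_inter)
  also have "vec.dim (x \<inter> (y \<inter> z)) \<le> vec.dim (x \<inter> z)"
    by (rule vec.dim_subset) auto
  finally show ?thesis
    by simp
qed

lemma subspaces_of_dim_eqI: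
  assumes "x \<in> subspaces_of_dim d" "y \<in> subspaces_of_dim d" "d \<le> vec.dim (x \<inter> y)"
  shows "x = y"
proof -
  have xy: "vec.subspace x" "vec.subspace y" "vec.dim x = d" "vec.dim y = d"
    using assms by (auto simp: subspaces_of_dim_def)
  have "x \<inter> y = x"
    using xy assms(3) by (intro vec.subspace_dim_equal vec.subspace_inter) auto
  moreover have "x \<inter> y = y"
    using xy assms(3) by (intro vec.subspace_dim_equal vec.subspace_inter) auto
  ultimately show ?thesis
    by simp
qed

text \<open>Positive counts guarantee shortest paths inside \<open>W\<close>, so that
  \<open>d - vec.dim (x \<inter> y)\<close> is the distance. The lemma serves the whole Grassmann
  graph as well as the subgraph of an extremal bitrade.\<close>

lemma distance_regular_induced_grassmann:
  fixes W :: "('a::{field, finite} ^ 'n::finite) set set"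
  assumes W: "W \<subseteq> subspaces_of_dim d" "W \<noteq> {}"
    and b: "\<And>x y. x \<in> W \<Longrightarrow> y \<in> W \<Longrightarrow>
      card {z \<in> W. vec.dim (y \<inter> z) = d - 1 \<and> Suc (vec.dim (x \<inter> z)) = vec.dim (x \<inter> y)} = b (d - vec.dim (x \<inter> y))"
    and c: "\<And>x y. x \<in> W \<Longrightarrow> y \<in> W \<Longrightarrow>
      card {z \<in> W. vec.dim (y \<inter> z) = d - 1 \<and> vec.dim (x \<inter> z) = Suc (vec.dim (x \<inter> y))} = c (d - vec.dim (x \<inter> y))"
    and b_pos: "\<And>i. i < d \<Longrightarrow> 0 < b i"
    and c_pos: "\<And>i. 0 < i \<Longrightarrow> i \<le> d \<Longrightarrow> 0 < c i"
  shows "distance_regular_with (induced_subgraph (grassmann_graph d) W) d b c"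
proof -
  define G where "G = induced_subgraph (grassmann_graph d) W"
  have verts: "verts G = W"
    by (simp add: G_def induced_subgraph_def)
  have adj: "(y, z) \<in> adj G \<longleftrightarrow> y \<in> W \<and> z \<in> W \<and> vec.dim (y \<inter> z) = d - 1" for y z
    using W(1) by (auto simp: G_def induced_subgraph_def grassmann_graph_def)
  have sub: "vec.subspace x" "vec.dim x = d" if "x \<in> W" for x
    using W(1) that by (auto simp: subspaces_of_dim_def)
  have dim_le: "vec.dim (x \<inter> y) \<le> d" if "x \<in> W" for x y
    using sub[OF that] vec.dim_subset[of "x \<inter> y" x] by simp
  have lower: "d - vec.dim (x \<inter> z) \<le> l" if "x \<in> W" "(x, z) \<in> adj G ^^ l" for x z l
    using that(2)
  proof (induction l arbitrary: z)
    case 0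
    then show ?case
      using sub[OF that(1)] by simp
  next
    case (Suc l)
    then obtain y where y: "(x, y) \<in> adj G ^^ l" "(y, z) \<in> adj G"
      by auto
    then have "vec.dim (x \<inter> y) \<le> Suc (vec.dim (x \<inter> z))"
      using W(1) sub[OF that(1)] by (intro dim_inter_le_adjacent[where d = d]) (auto simp: adj)
    then show ?case
      using Suc.IH[OF y(1)] by linarith
  qed
  have upper: "(x, y) \<in> adj G ^^ (d - vec.dim (x \<inter> y))" if "x \<in> W" "y \<in> W" for x y
    using that(2)
  proof (induction "d - vec.dim (x \<inter> y)" arbitrary: y)
    case 0
    then have "x = y"
      using W(1) that(1) by (intro subspaces_of_dim_eqI[of _ d]) auto
    then show ?case
      using sub[OF that(1)] by simp
  next
    case (Suc l)
    \<comment> \<open>A positive \<open>c\<close> provides a neighbour \<open>z\<close> of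
      \<open>y\<close> one step closer to \<open>x\<close>; the path to \<open>z\<close> is extended
      by the edge back to \<open>y\<close>.\<close>
    have "0 < c (d - vec.dim (x \<inter> y))"
      using Suc.hyps(2) by (intro c_pos) auto
    then have "{z \<in> W. vec.dim (y \<inter> z) = d - 1 \<and> vec.dim (x \<inter> z) = Suc (vec.dim (x \<inter> y))} \<noteq> {}"
      using c[OF that(1) Suc.prems] by (metis card.empty less_irrefl)
    then obtain z where z: "z \<in> W" "vec.dim (y \<inter> z) = d - 1" "vec.dim (x \<inter> z) = Suc (vec.dim (x \<inter> y))"
      by blast
    have l: "l = d - vec.dim (x \<inter> z)"
      using z(3) Suc.hyps(2) by simp
    have "(x, z) \<in> adj G ^^ l"
      using Suc.hyps(1)[OF l z(1)] l by simp
    moreover have "(z, y) \<in> adj G"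
      using z Suc.prems by (simp add: adj Int_commute)
    ultimately have "(x, y) \<in> adj G ^^ Suc l"
      by auto
    then show ?case
      using Suc.hyps(2) by simp
  qed
  have dist: "gdist G x y = d - vec.dim (x \<inter> y)" if "x \<in> W" "y \<in> W" for x y
    unfolding gdist_def using lower upper that by (intro Least_equality) auto
  \<comment> \<open>Positive values of \<open>b\<close> permit steps away from \<open>x\<close>
    until codimension \<open>d\<close> is reached, so the diameter is no smaller than
    \<open>d\<close>.\<close>
  have far: "\<exists>y\<in>W. d - vec.dim (x \<inter> y) = i" if "x \<in> W" "i \<le> d" for x i
    using that(2)
  proof (induction i)
    case 0
    then show ?case
      using that(1) sub by (auto intro!: bexI[of _ x])
  next
    case (Suc i)
    then obtain y where y: "y \<in> W" "d - vec.dim (x \<inter> y) = i"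
      by auto
    then have "{z \<in> W. vec.dim (y \<inter> z) = d - 1 \<and> Suc (vec.dim (x \<inter> z)) = vec.dim (x \<inter> y)} \<noteq> {}"
      using b[OF that(1) y(1)] b_pos[of i] Suc.prems by (metis Suc_le_lessD card.empty less_irrefl)
    then obtain z where "z \<in> W" "Suc (vec.dim (x \<inter> z)) = vec.dim (x \<inter> y)"
      by blast
    then show ?case
      using y dim_le[OF that(1), of y] by (intro bexI[of _ z]) auto
  qed
  have "finite (verts G)"
    by simp
  moreover have "connected_graph G"
    unfolding connected_graph_def verts using W(2) upper relpow_imp_rtrancl by blast
  moreover have "diameter_graph G = d"
    unfolding diameter_graph_def
  proof (rule Max_eqI)
    have "{gdist G x y |x y. x \<in> verts G \<and> y \<in> verts G} = (\<lambda>(x, y). gdist G x y) ` (W \<times> W)"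
      by (auto simp: verts)
    then show "finite {gdist G x y |x y. x \<in> verts G \<and> y \<in> verts G}"
      by simp
    show "l \<le> d" if "l \<in> {gdist G x y |x y. x \<in> verts G \<and> y \<in> verts G}" for l
      using that dist by (auto simp: verts)
    obtain x where "x \<in> W"
      using W(2) by blast
    with far[OF this order_refl] dist show "d \<in> {gdist G x y |x y. x \<in> verts G \<and> y \<in> verts G}"
      by (force simp: verts)
  qed
  moreover have "card {z \<in> verts G. (y, z) \<in> adj G \<and> gdist G x z = gdist G x y + 1} = b (gdist G x y) \<and>
      card {z \<in> verts G. (y, z) \<in> adj G \<and> gdist G x z + 1 = gdist G x y} = c (gdist G x y)"
    if xy: "x \<in> verts G" "y \<in> verts G" for x y
  proof -
    have x: "x \<in> W" and y: "y \<in> W"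
      using xy verts by auto
    \<comment> \<open>Distances are truncated differences; since no intersection has dimension above
      \<open>d\<close>, they can be compared through the dimensions.\<close>
    have farther_iff: "d - vec.dim (x \<inter> z) = Suc (d - vec.dim (x \<inter> y)) \<longleftrightarrow> Suc (vec.dim (x \<inter> z)) = vec.dim (x \<inter> y)"
      and closer_iff: "Suc (d - vec.dim (x \<inter> z)) = d - vec.dim (x \<inter> y) \<longleftrightarrow> vec.dim (x \<inter> z) = Suc (vec.dim (x \<inter> y))" for z
      using dim_le[OF x, of y] dim_le[OF x, of z] by linarith+
    have "{z \<in> W. (y, z) \<in> adj G \<and> gdist G x z = gdist G x y + 1} =
        {z \<in> W. vec.dim (y \<inter> z) = d - 1 \<and> Suc (vec.dim (x \<inter> z)) = vec.dim (x \<inter> y)}"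
      by (rule Collect_cong) (use x y in \<open>simp add: adj dist farther_iff cong: conj_cong\<close>)
    moreover have "{z \<in> W. (y, z) \<in> adj G \<and> gdist G x z + 1 = gdist G x y} =
        {z \<in> W. vec.dim (y \<inter> z) = d - 1 \<and> vec.dim (x \<inter> z) = Suc (vec.dim (x \<inter> y))}"
      by (rule Collect_cong) (use x y in \<open>simp add: adj dist closer_iff cong: conj_cong\<close>)
    ultimately show ?thesis
      using b[OF x y] c[OF x y] dist[OF x y] by (simp add: verts)
  qed
  ultimately show ?thesis
    unfolding distance_regular_with_def G_def by blast
qed

text \<open>A neighbour \<open>z\<close> of \<open>y\<close> determines the subspace
  \<open>y \<inter> z\<close> of dimension \<open>d - 1\<close>, so neighbours can be counted one
  hyperplane of \<open>y\<close> at a time.\<close>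

lemma card_neighbours_eq_sum_hyperplanes:
  fixes y :: "('a::{field, finite} ^ 'n::finite) set"
  assumes W: "W \<subseteq> subspaces_of_dim d" and y: "y \<in> subspaces_of_dim d"
  shows "card {z \<in> W. vec.dim (y \<inter> z) = d - 1 \<and> P z} =
    (\<Sum>U\<in>subspaces_between {0} y (d - 1). card {z \<in> W. y \<inter> z = U \<and> P z})"
proof -
  let ?Z = "{z \<in> W. vec.dim (y \<inter> z) = d - 1 \<and> P z}"
  have "(\<Sum>U\<in>subspaces_between {0} y (d - 1). \<Sum>z | z \<in> ?Z \<and> y \<inter> z = U. 1 :: nat) = (\<Sum>z\<in>?Z. 1)"
  proof (intro sum.group)
    show "(\<lambda>z. y \<inter> z) ` ?Z \<subseteq> subspaces_between {0} y (d - 1)"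
      using W y by (force simp: subspaces_between_def subspaces_of_dim_def vec.subspace_inter vec.subspace_0)
  qed auto
  moreover have "{z. z \<in> ?Z \<and> y \<inter> z = U} = {z \<in> W. y \<inter> z = U \<and> P z}"
    if "U \<in> subspaces_between {0} y (d - 1)" for U
    using that by (auto simp: subspaces_between_def)
  ultimately show ?thesis
    by simp
qed

text \<open>For use with \<open>A = x \<inter> y\<close>: hyperplanes of \<open>y\<close> through
  \<open>A\<close> account for the neighbours closer to \<open>x\<close>, the others for those
  farther away. The second count is a difference of q-integers, evaluated by
  \<open>q_int_add\<close>.\<close>

lemma card_hyperplanes_containing:
  fixes A y :: "('a::{field, finite} ^ 'n::finite) set"
  assumes "0 < d" "y \<in> subspaces_of_dim d" "vec.subspace A" "A \<subseteq> y"
  shows "card {U \<in> subspaces_between {0} y (d - 1). A \<subseteq> U} = q_int CARD('a) (d - vec.dim A)"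
    and "card {U \<in> subspaces_between {0} y (d - 1). \<not> A \<subseteq> U} =
      CARD('a) ^ (d - vec.dim A) * q_int CARD('a) (vec.dim A)"
proof -
  let ?H = "subspaces_between {0} y (d - 1)"
  have y: "vec.subspace y" "vec.dim y = d"
    using assms by (auto simp: subspaces_of_dim_def)
  have "{U \<in> ?H. A \<subseteq> U} = subspaces_between A y (d - 1)"
    using vec.subspace_0 by (auto simp: subspaces_between_def)
  then show A: "card {U \<in> ?H. A \<subseteq> U} = q_int CARD('a) (d - vec.dim A)"
    using assms y by (simp add: card_hyperplanes_above)
  have "card ?H = q_int CARD('a) d"
    using y assms(1) by (subst card_hyperplanes_above) (auto simp: vec.subspace_0)
  moreover have "card ?H = card {U \<in> ?H. A \<subseteq> U} + card {U \<in> ?H. \<not> A \<subseteq> U}"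
    by (subst card_Un_disjoint[symmetric]) (auto intro: arg_cong[of _ _ card])
  moreover have "vec.dim A \<le> d"
    using y assms vec.dim_subset by blast
  ultimately show "card {U \<in> ?H. \<not> A \<subseteq> U} = CARD('a) ^ (d - vec.dim A) * q_int CARD('a) (vec.dim A)"
    using A q_int_add[of "CARD('a)" "d - vec.dim A" "vec.dim A"] by simp
qed

theorem extremal_bitrade_distance_regular:
  fixes T0 T1 :: "('a::{field, finite} ^ 'n::finite) set set"
  assumes d: "0 < d" and T: "steiner_bitrade d T0 T1"
    and min: "real (card (T0 \<union> T1)) = (\<Prod>l<d. 1 + real CARD('a) ^ l)"
  shows "distance_regular_with (induced_subgraph (grassmann_graph d) (T0 \<union> T1)) d
    (\<lambda>i. CARD('a) ^ i * q_int CARD('a) (d - i)) (q_int CARD('a))"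
proof -
  let ?T = "T0 \<union> T1" and ?H = "\<lambda>y. subspaces_between {0} y (d - 1)"
  have sub: "?T \<subseteq> subspaces_of_dim d" "?T \<noteq> {}"
    using T by (auto simp: steiner_bitrade_def)
  \<comment> \<open>The codimension is \<open>1\<close>, and \<open>1 choose 2 = 0\<close> makes the
    sphere a single member.\<close>
  have one: "card {z \<in> ?T. y \<inter> z = U} = 1" if "y \<in> ?T" "U \<in> ?H y" for y U
    using extremal_bitrade_sphere[OF T that(1) _ _ min, of U] that(2) d
    by (simp add: subspaces_between_def Int_commute numeral_2_eq_2)
  have dim_step: "if x \<inter> y \<subseteq> U then vec.dim (x \<inter> z) = Suc (vec.dim (x \<inter> y))
      else Suc (vec.dim (x \<inter> z)) = vec.dim (x \<inter> y)"
    if x: "x \<in> ?T" and y: "y \<in> ?T" and U: "U \<in> ?H y" and z: "z \<in> ?T" "y \<inter> z = U" for x y z U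
  proof -
    have xyz: "vec.subspace x" "vec.subspace y" "vec.subspace z" "vec.dim y = d" "vec.dim z = d"
      using x y z sub(1) by (auto simp: subspaces_of_dim_def)
    have U': "vec.subspace U" "vec.dim U = d - 1" "U \<subseteq> y"
      using U by (auto simp: subspaces_between_def)
    have le: "vec.dim (x \<inter> w) \<le> d" if "w \<in> ?T" for w
      using vec.dim_subset[of "x \<inter> w" w] that sub(1) by (auto simp: subspaces_of_dim_def)
    \<comment> \<open>\<open>U\<close> has codimension one, so the sign flips between
      \<open>y\<close> and \<open>z\<close>; expressing both signs through \<open>x\<close> shows
      that the two intersections with \<open>x\<close> cannot have the same dimension.\<close>
    have "bitrade_sign T0 T1 z = - bitrade_sign T0 T1 y"
      using extremal_bitrade_sign[OF T y z(1) min] z(2) U' d by simp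
    then have "(- 1) ^ (d - vec.dim (x \<inter> z)) * bitrade_sign T0 T1 x =
        - ((- 1) ^ (d - vec.dim (x \<inter> y)) * bitrade_sign T0 T1 x)"
      using extremal_bitrade_sign[OF T x y min] extremal_bitrade_sign[OF T x z(1) min] by simp
    moreover have "bitrade_sign T0 T1 x \<noteq> 0"
      using abs_bitrade_sign[OF T x] by auto
    ultimately have "(- 1 :: real) ^ (d - vec.dim (x \<inter> z)) = - ((- 1) ^ (d - vec.dim (x \<inter> y)))"
      by (metis mult_minus_left mult_right_cancel)
    then have "d - vec.dim (x \<inter> z) \<noteq> d - vec.dim (x \<inter> y)"
      by (metis neg_equal_zero power_eq_0_iff neg_equal_0_iff_equal zero_neq_one)
    then have neq: "vec.dim (x \<inter> z) \<noteq> vec.dim (x \<inter> y)"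
      by metis
    \<comment> \<open>Both dimensions are \<open>vec.dim (x \<inter> U)\<close> or one more, and
      being different they take one value each; whether \<open>x \<inter> y \<subseteq> U\<close>
      decides which.\<close>
    have Uy: "vec.dim (x \<inter> y) \<le> Suc (vec.dim (x \<inter> U))" and Uz: "vec.dim (x \<inter> z) \<le> Suc (vec.dim (x \<inter> U))"
      using xyz U' z(2) by (intro dim_inter_le_one_dimensional_extension; auto)+
    have Uz': "vec.dim (x \<inter> U) \<le> vec.dim (x \<inter> z)"
      using z(2) by (intro vec.dim_subset) auto
    show ?thesis
    proof (cases "x \<inter> y \<subseteq> U")
      case True
      then have "x \<inter> U = x \<inter> y"
        using U' by auto
      then show ?thesis
        using True neq Uz Uz' by auto
    next
      case False
      have "vec.dim (x \<inter> U) < vec.dim (x \<inter> y)"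
      proof (rule ccontr)
        assume "\<not> vec.dim (x \<inter> U) < vec.dim (x \<inter> y)"
        then have "x \<inter> U = x \<inter> y"
          using xyz U' by (intro vec.subspace_dim_equal) (auto intro: vec.subspace_inter)
        then show False
          using False by auto
      qed
      then show ?thesis
        using False neq Uy Uz Uz' by auto
    qed
  qed
  have sphere_b: "card {z \<in> ?T. vec.dim (y \<inter> z) = d - 1 \<and> Suc (vec.dim (x \<inter> z)) = vec.dim (x \<inter> y)} =
      card {U \<in> ?H y. \<not> x \<inter> y \<subseteq> U}" if x: "x \<in> ?T" and y: "y \<in> ?T" for x y
  proof -
    have "card {z \<in> ?T. y \<inter> z = U \<and> Suc (vec.dim (x \<inter> z)) = vec.dim (x \<inter> y)} =
        (if x \<inter> y \<subseteq> U then 0 else 1)" if U: "U \<in> ?H y" for U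
    proof -
      have "Suc (vec.dim (x \<inter> z)) = vec.dim (x \<inter> y) \<longleftrightarrow> \<not> x \<inter> y \<subseteq> U"
        if "z \<in> ?T" "y \<inter> z = U" for z
        using dim_step[OF x y U that] by (cases "x \<inter> y \<subseteq> U") simp_all
      then have "{z \<in> ?T. y \<inter> z = U \<and> Suc (vec.dim (x \<inter> z)) = vec.dim (x \<inter> y)} =
          (if x \<inter> y \<subseteq> U then {} else {z \<in> ?T. y \<inter> z = U})"
        by (cases "x \<inter> y \<subseteq> U") auto
      then show ?thesis
        using one[OF y U] by simp
    qed
    then show ?thesis
      using y sub(1) by (subst card_neighbours_eq_sum_hyperplanes) (auto simp: sum.If_cases Int_def)
  qed
  have sphere_c: "card {z \<in> ?T. vec.dim (y \<inter> z) = d - 1 \<and> vec.dim (x \<inter> z) = Suc (vec.dim (x \<inter> y))} =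
      card {U \<in> ?H y. x \<inter> y \<subseteq> U}" if x: "x \<in> ?T" and y: "y \<in> ?T" for x y
  proof -
    have "card {z \<in> ?T. y \<inter> z = U \<and> vec.dim (x \<inter> z) = Suc (vec.dim (x \<inter> y))} =
        (if x \<inter> y \<subseteq> U then 1 else 0)" if U: "U \<in> ?H y" for U
    proof -
      have "vec.dim (x \<inter> z) = Suc (vec.dim (x \<inter> y)) \<longleftrightarrow> x \<inter> y \<subseteq> U"
        if "z \<in> ?T" "y \<inter> z = U" for z
        using dim_step[OF x y U that] by (cases "x \<inter> y \<subseteq> U") simp_all
      then have "{z \<in> ?T. y \<inter> z = U \<and> vec.dim (x \<inter> z) = Suc (vec.dim (x \<inter> y))} =
          (if x \<inter> y \<subseteq> U then {z \<in> ?T. y \<inter> z = U} else {})"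
        by (cases "x \<inter> y \<subseteq> U") auto
      then show ?thesis
        using one[OF y U] by simp
    qed
    then show ?thesis
      using y sub(1) by (subst card_neighbours_eq_sum_hyperplanes) (auto simp: sum.If_cases Int_def)
  qed
  show ?thesis
  proof (rule distance_regular_induced_grassmann[OF sub])
    fix x y assume x: "x \<in> ?T" and y: "y \<in> ?T"
    have xy: "vec.subspace (x \<inter> y)" "y \<in> subspaces_of_dim d" "vec.dim (x \<inter> y) \<le> d"
      using x y sub(1) vec.dim_subset[of "x \<inter> y" y]
      by (auto simp: subspaces_of_dim_def intro: vec.subspace_inter)
    show "card {z \<in> ?T. vec.dim (y \<inter> z) = d - 1 \<and> Suc (vec.dim (x \<inter> z)) = vec.dim (x \<inter> y)} =
        CARD('a) ^ (d - vec.dim (x \<inter> y)) * q_int CARD('a) (d - (d - vec.dim (x \<inter> y)))"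
      using sphere_b[OF x y] card_hyperplanes_containing(2)[OF d xy(2,1)] xy(3) by simp
    show "card {z \<in> ?T. vec.dim (y \<inter> z) = d - 1 \<and> vec.dim (x \<inter> z) = Suc (vec.dim (x \<inter> y))} =
        q_int CARD('a) (d - vec.dim (x \<inter> y))"
      using sphere_c[OF x y] card_hyperplanes_containing(1)[OF d xy(2,1)] by simp
  qed (auto intro: q_int_pos)
qed


section \<open>The Grassmann graph\<close>

text \<open>Passing from \<open>U\<close> to \<open>z\<close> adds one to the dimension formula with
  \<open>x\<close>; this surplus goes into the intersection exactly when the sum with
  \<open>x\<close> does not grow.\<close>

lemma dim_inter_extension:
  assumes x: "vec.subspace x" and U: "vec.subspace U" and z: "vec.subspace z"
    and Uz: "U \<subseteq> z" "vec.dim z = Suc (vec.dim U)"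
  shows "vec.dim (x \<inter> z) = (if z \<subseteq> vec.span (U \<union> x) then Suc (vec.dim (x \<inter> U)) else vec.dim (x \<inter> U))"
proof -
  have sum_z: "vec.dim (vec.span (z \<union> x)) + vec.dim (x \<inter> z) = Suc (vec.dim U) + vec.dim x"
    using dim_span_Un[OF z x] Uz by (simp add: Int_commute)
  have sum_U: "vec.dim (vec.span (U \<union> x)) + vec.dim (x \<inter> U) = vec.dim U + vec.dim x"
    using dim_span_Un[OF U x] by (simp add: Int_commute)
  have sub: "vec.span (U \<union> x) \<subseteq> vec.span (z \<union> x)"
    using Uz by (intro vec.span_mono) auto
  have z_sub: "z \<subseteq> vec.span (z \<union> x)"
    using vec.span_superset by blast
  show ?thesis
  proof (cases "z \<subseteq> vec.span (U \<union> x)")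
    case True
    then have "vec.span (z \<union> x) \<subseteq> vec.span (U \<union> x)"
      using vec.span_superset[of "U \<union> x"] by (intro vec.span_minimal) auto
    then have "vec.span (z \<union> x) = vec.span (U \<union> x)"
      using sub by blast
    then show ?thesis
      using True sum_z sum_U by simp
  next
    case False
    have "\<not> vec.dim (vec.span (z \<union> x)) \<le> vec.dim (vec.span (U \<union> x))"
    proof
      assume "vec.dim (vec.span (z \<union> x)) \<le> vec.dim (vec.span (U \<union> x))"
      then have "vec.span (U \<union> x) = vec.span (z \<union> x)"
        using sub by (intro vec.subspace_dim_equal) auto
      then show False
        using False z_sub by simp
    qed
    moreover have "vec.dim (x \<inter> U) \<le> vec.dim (x \<inter> z)"
      using Uz by (intro vec.dim_subset) auto
    ultimately show ?thesis
      using False sum_z sum_U by simp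
  qed
qed

text \<open>For \<open>x\<close>, \<open>y\<close> at distance \<open>i\<close>,
  \<open>q ^ i * q_int q (d - i)\<close> hyperplanes \<open>U\<close> of \<open>y\<close> do not
  contain \<open>x \<inter> y\<close>, and each has \<open>q ^ Suc i * q_int q (n - d - i)\<close>
  one-dimensional extensions outside \<open>U + x\<close>. In \<open>grassmann_c\<close> the factors
  count the hyperplanes containing \<open>x \<inter> y\<close> and the extensions inside
  \<open>U + x\<close>.\<close>

definition grassmann_b :: "nat \<Rightarrow> nat \<Rightarrow> nat \<Rightarrow> nat \<Rightarrow> nat" where
  "grassmann_b q n d i = q ^ i * q_int q (d - i) * (q ^ Suc i * q_int q (n - d - i))"

definition grassmann_c :: "nat \<Rightarrow> nat \<Rightarrow> nat" where
  "grassmann_c q i = q_int q i * q_int q i"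

lemma sum_indicator_const:
  "finite A \<Longrightarrow> (\<Sum>x\<in>A. if P x then k else 0) = card {x \<in> A. P x} * (k :: nat)"
  by (simp flip: sum.inter_filter)

theorem grassmann_distance_regular:
  assumes d: "0 < d" "2 * d \<le> CARD('n::finite)"
  shows "distance_regular_with (grassmann_graph d :: ('a::{field, finite} ^ 'n) set graph) d
    (grassmann_b CARD('a) CARD('n) d) (grassmann_c CARD('a))"
proof -
  let ?S = "subspaces_of_dim d :: ('a ^ 'n) set set" and ?q = "CARD('a)"
  let ?H = "\<lambda>y. subspaces_between {0} y (d - 1) :: ('a ^ 'n) set set"
  have dim_UNIV: "vec.dim (UNIV :: ('a ^ 'n) set) = CARD('n)"
    by (simp add: card_cart_basis)
  obtain x0 :: "('a ^ 'n) set" where "vec.subspace x0" "vec.dim x0 = d"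
    using vec.choose_subspace_of_subspace[of d "UNIV :: ('a ^ 'n) set"] d dim_UNIV by auto
  then have ne: "?S \<noteq> {}"
    by (auto simp: subspaces_of_dim_def)
  have layer: "card {z \<in> ?S. y \<inter> z = U \<and> vec.dim (x \<inter> z) = Suc (vec.dim (x \<inter> y))} =
        (if x \<inter> y \<subseteq> U then q_int ?q (d - vec.dim (x \<inter> y)) else 0)"
      "card {z \<in> ?S. y \<inter> z = U \<and> Suc (vec.dim (x \<inter> z)) = vec.dim (x \<inter> y)} =
        (if \<not> x \<inter> y \<subseteq> U
         then ?q ^ Suc (d - vec.dim (x \<inter> y)) * q_int ?q (CARD('n) - d - (d - vec.dim (x \<inter> y))) else 0)"
    if x: "x \<in> ?S" and y: "y \<in> ?S" and U: "U \<in> ?H y" for x y U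
  proof -
    \<comment> \<open>The one-dimensional extensions of \<open>U\<close> inside \<open>K\<close> are
      those whose intersection with \<open>x\<close> grows.\<close>
    define K where "K = vec.span (U \<union> x)"
    have xy: "vec.subspace x" "vec.subspace y" "vec.dim x = d" "vec.dim y = d"
      using x y by (auto simp: subspaces_of_dim_def)
    have U': "vec.subspace U" "vec.dim U = d - 1" "U \<subseteq> y" "Suc (vec.dim U) = d"
      using U d by (auto simp: subspaces_between_def)
    have K: "vec.subspace K" "U \<subseteq> K"
      unfolding K_def using vec.span_superset[of "U \<union> x"] by auto
    have dim_K: "vec.dim K + vec.dim (x \<inter> U) = vec.dim U + d"
      using dim_span_Un[OF U'(1) xy(1)] xy(3) by (simp add: K_def Int_commute)
    have inter: "vec.dim (x \<inter> z) = (if z \<subseteq> K then Suc (vec.dim (x \<inter> U)) else vec.dim (x \<inter> U))"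
      if "z \<in> subspaces_between U UNIV d" for z
      unfolding K_def using that xy U' by (intro dim_inter_extension) (auto simp: subspaces_between_def)
    have y_in: "y \<in> subspaces_between U UNIV d"
      using xy U' by (auto simp: subspaces_between_def)
    \<comment> \<open>Distinct \<open>d\<close>-subspaces above the
      \<open>(d - 1)\<close>-dimensional \<open>U\<close> meet exactly in \<open>U\<close>.\<close>
    have fibre: "z \<in> ?S \<and> y \<inter> z = U \<longleftrightarrow> z \<in> subspaces_between U UNIV d \<and> z \<noteq> y" for z
    proof
      assume "z \<in> ?S \<and> y \<inter> z = U"
      then show "z \<in> subspaces_between U UNIV d \<and> z \<noteq> y"
        using xy U' d by (auto simp: subspaces_between_def subspaces_of_dim_def)
    next
      assume z: "z \<in> subspaces_between U UNIV d \<and> z \<noteq> y"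
      then have z': "z \<in> ?S" "vec.subspace z" "U \<subseteq> y \<inter> z"
        using U' by (auto simp: subspaces_between_def subspaces_of_dim_def)
      have "\<not> d \<le> vec.dim (y \<inter> z)"
        using subspaces_of_dim_eqI[OF y z'(1)] z by auto
      then have "U = y \<inter> z"
        using U' z' xy by (intro vec.subspace_dim_equal) (auto intro: vec.subspace_inter)
      then show "z \<in> ?S \<and> y \<inter> z = U"
        using z' by simp
    qed
    have below: "subspaces_between U K d = {z \<in> subspaces_between U UNIV d. z \<subseteq> K}"
      by (auto simp: subspaces_between_def)
    have card_below: "card (subspaces_between U K d) = q_int ?q (vec.dim K - vec.dim U)"
      using card_subspaces_above[OF U'(1) K] U'(4) by simp
    have card_above: "card (subspaces_between U UNIV d) = q_int ?q (CARD('n) - vec.dim U)"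
      using card_subspaces_above[OF U'(1), of UNIV] U'(4) dim_UNIV by simp
    have x_y: "vec.dim (x \<inter> y) \<le> d"
      using vec.dim_subset[of "x \<inter> y" y] xy by simp
    have smaller: "vec.dim (x \<inter> U) \<noteq> vec.dim (x \<inter> y)" if "\<not> x \<inter> y \<subseteq> U"
    proof
      assume "vec.dim (x \<inter> U) = vec.dim (x \<inter> y)"
      then have "x \<inter> U = x \<inter> y"
        using xy U' by (intro vec.subspace_dim_equal vec.subspace_inter) auto
      then show False
        using that by blast
    qed
    have fibre_set: "{z \<in> ?S. y \<inter> z = U \<and> P z} = {z \<in> subspaces_between U UNIV d. z \<noteq> y \<and> P z}" for P
      using fibre by blast
    show "card {z \<in> ?S. y \<inter> z = U \<and> vec.dim (x \<inter> z) = Suc (vec.dim (x \<inter> y))} =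
        (if x \<inter> y \<subseteq> U then q_int ?q (d - vec.dim (x \<inter> y)) else 0)"
    proof (cases "x \<inter> y \<subseteq> U")
      case True
      then have xU: "x \<inter> U = x \<inter> y"
        using U' by auto
      \<comment> \<open>Here \<open>y\<close> gains nothing over \<open>U\<close> in its
        intersection with \<open>x\<close>, so it is not among the extensions inside
        \<open>K\<close>.\<close>
      have yK: "\<not> y \<subseteq> K"
        using inter[OF y_in] xU by (auto split: if_splits)
      have "z \<noteq> y \<and> vec.dim (x \<inter> z) = Suc (vec.dim (x \<inter> y)) \<longleftrightarrow> z \<subseteq> K"
        if "z \<in> subspaces_between U UNIV d" for z
        using inter[OF that] xU yK by (cases "z \<subseteq> K") auto
      then have "{z \<in> subspaces_between U UNIV d. z \<noteq> y \<and> vec.dim (x \<inter> z) = Suc (vec.dim (x \<inter> y))} =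
          subspaces_between U K d"
        unfolding below by blast
      moreover have "vec.dim K - vec.dim U = d - vec.dim (x \<inter> y)"
        using dim_K xU by simp
      ultimately show ?thesis
        using True card_below by (simp add: fibre_set)
    next
      case False
      then have "vec.dim (x \<inter> U) \<noteq> vec.dim (x \<inter> y)"
        by (rule smaller)
      then have "vec.dim (x \<inter> z) \<noteq> Suc (vec.dim (x \<inter> y))" if "z \<in> subspaces_between U UNIV d" for z
        using inter[OF that] inter[OF y_in] by (simp split: if_splits)
      then have "{z \<in> subspaces_between U UNIV d. z \<noteq> y \<and> vec.dim (x \<inter> z) = Suc (vec.dim (x \<inter> y))} = {}"
        by blast
      then show ?thesis
        using False by (simp add: fibre_set)
    qed
    show "card {z \<in> ?S. y \<inter> z = U \<and> Suc (vec.dim (x \<inter> z)) = vec.dim (x \<inter> y)} =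
        (if \<not> x \<inter> y \<subseteq> U
         then ?q ^ Suc (d - vec.dim (x \<inter> y)) * q_int ?q (CARD('n) - d - (d - vec.dim (x \<inter> y))) else 0)"
    proof (cases "x \<inter> y \<subseteq> U")
      case True
      then have xU: "x \<inter> U = x \<inter> y"
        using U' by auto
      then have "Suc (vec.dim (x \<inter> z)) \<noteq> vec.dim (x \<inter> y)" if "z \<in> subspaces_between U UNIV d" for z
        using inter[OF that] by (simp split: if_splits)
      then have "{z \<in> subspaces_between U UNIV d. z \<noteq> y \<and> Suc (vec.dim (x \<inter> z)) = vec.dim (x \<inter> y)} = {}"
        by blast
      then show ?thesis
        using True by (simp add: fibre_set)
    next
      case False
      then have "vec.dim (x \<inter> U) \<noteq> vec.dim (x \<inter> y)"
        by (rule smaller)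
      \<comment> \<open>Here \<open>y\<close> itself lies in \<open>K\<close>, so the extensions
        outside \<open>K\<close> are automatically different from \<open>y\<close>.\<close>
      then have yK: "y \<subseteq> K" and dxy: "vec.dim (x \<inter> y) = Suc (vec.dim (x \<inter> U))"
        using inter[OF y_in] by (auto split: if_splits)
      have "z \<noteq> y \<and> Suc (vec.dim (x \<inter> z)) = vec.dim (x \<inter> y) \<longleftrightarrow> \<not> z \<subseteq> K"
        if "z \<in> subspaces_between U UNIV d" for z
        using inter[OF that] dxy yK by (cases "z \<subseteq> K") auto
      then have "{z \<in> subspaces_between U UNIV d. z \<noteq> y \<and> Suc (vec.dim (x \<inter> z)) = vec.dim (x \<inter> y)} =
          subspaces_between U UNIV d - subspaces_between U K d"
        unfolding below by blast
      then have "card {z \<in> ?S. y \<inter> z = U \<and> Suc (vec.dim (x \<inter> z)) = vec.dim (x \<inter> y)} =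
          q_int ?q (CARD('n) - vec.dim U) - q_int ?q (vec.dim K - vec.dim U)"
        using card_below card_above by (simp add: fibre_set card_Diff_subset below)
      also have "vec.dim K - vec.dim U = Suc (d - vec.dim (x \<inter> y))"
        using dim_K dxy x_y by simp
      \<comment> \<open>The bound \<open>2 * d \<le> CARD('n)\<close> makes the truncated
        differences exact; \<open>q_int_add\<close> then turns the difference of q-integers into a
        product.\<close>
      also have "CARD('n) - vec.dim U = Suc (d - vec.dim (x \<inter> y)) + (CARD('n) - d - (d - vec.dim (x \<inter> y)))"
        using U'(4) d dxy x_y by simp
      finally show ?thesis
        using False by (simp only: q_int_add) simp
    qed
  qed
  have "distance_regular_with (induced_subgraph (grassmann_graph d) ?S) d
      (grassmann_b CARD('a) CARD('n) d) (grassmann_c CARD('a))"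
  proof (rule distance_regular_induced_grassmann[OF order_refl ne])
    fix x y assume x: "x \<in> ?S" and y: "y \<in> ?S"
    have xy: "vec.subspace (x \<inter> y)" "x \<inter> y \<subseteq> y" "vec.dim (x \<inter> y) \<le> d"
      using x y vec.dim_subset[of "x \<inter> y" y] by (auto simp: subspaces_of_dim_def intro: vec.subspace_inter)
    let ?m = "d - vec.dim (x \<inter> y)"
    have "card {z \<in> ?S. vec.dim (y \<inter> z) = d - 1 \<and> Suc (vec.dim (x \<inter> z)) = vec.dim (x \<inter> y)} =
        (\<Sum>U\<in>?H y. if \<not> x \<inter> y \<subseteq> U then ?q ^ Suc ?m * q_int ?q (CARD('n) - d - ?m) else 0)"
      unfolding card_neighbours_eq_sum_hyperplanes[OF order_refl y]
      by (intro sum.cong refl layer(2)[OF x y])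
    also have "\<dots> = grassmann_b ?q CARD('n) d ?m"
      unfolding sum_indicator_const[OF finite] card_hyperplanes_containing(2)[OF d(1) y xy(1,2)]
      using xy(3) by (simp add: grassmann_b_def)
    finally show "card {z \<in> ?S. vec.dim (y \<inter> z) = d - 1 \<and> Suc (vec.dim (x \<inter> z)) = vec.dim (x \<inter> y)} =
        grassmann_b ?q CARD('n) d ?m" .
    have "card {z \<in> ?S. vec.dim (y \<inter> z) = d - 1 \<and> vec.dim (x \<inter> z) = Suc (vec.dim (x \<inter> y))} =
        (\<Sum>U\<in>?H y. if x \<inter> y \<subseteq> U then q_int ?q ?m else 0)"
      unfolding card_neighbours_eq_sum_hyperplanes[OF order_refl y]
      by (intro sum.cong refl layer(1)[OF x y])
    also have "\<dots> = grassmann_c ?q ?m"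
      unfolding sum_indicator_const[OF finite] card_hyperplanes_containing(1)[OF d(1) y xy(1,2)]
        grassmann_c_def ..
    finally show "card {z \<in> ?S. vec.dim (y \<inter> z) = d - 1 \<and> vec.dim (x \<inter> z) = Suc (vec.dim (x \<inter> y))} =
        grassmann_c ?q ?m" .
  qed (use d q_int_pos in \<open>auto simp: grassmann_b_def grassmann_c_def\<close>)
  moreover have "induced_subgraph (grassmann_graph d) ?S = grassmann_graph d"
    by (auto simp: induced_subgraph_def grassmann_graph_def)
  ultimately show ?thesis
    by simp
qed

section \<open>The w.d. bound of the Grassmann graph\<close>

lemma gauss_binomial_1: "2 \<le> q \<Longrightarrow> gauss_binomial q m 1 = real (q_int q m)"
  using q_int_mult_real[of q m] by (simp add: gauss_binomial_def field_simps)

text \<open>The closed form is the signed count of bitrade members at distance \<open>i\<close> from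
  a member, relative to its sign: \<open>gauss_binomial q d i\<close> subspaces of codimension
  \<open>i\<close>, each contributing as in \<open>bitrade_sign_sphere\<close>. Induction checks it
  against the recurrence.\<close>

lemma wd_W_grassmann:
  fixes q n d :: nat
  defines "w \<equiv> \<lambda>i. (- 1) ^ i * real q ^ (i choose 2) * gauss_binomial q d i"
  assumes q: "2 \<le> q" and n: "2 * d \<le> n" and i: "i \<le> d"
  shows "wd_W (grassmann_b q n d) (grassmann_c q) (- real (q_int q d)) i = w i"
  using i
proof (induction i rule: less_induct)
  case (less i)
  let ?b = "grassmann_b q n d" and ?c = "grassmann_c q"
  let ?I = "\<lambda>m. real (q_int q m)"
  \<comment> \<open>The ratio of consecutive values with its denominator cleared; at
    \<open>j\<close> and at \<open>m\<close> it expresses both neighbours of \<open>w m\<close>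
    through \<open>w m\<close>.\<close>
  have w_Suc: "w (Suc j) * ?I (Suc j) = - (real q ^ j * ?I (d - j)) * w j" for j
  proof -
    have "(real q - 1) * (w (Suc j) * ?I (Suc j)) = w (Suc j) * (real q ^ Suc j - 1)"
      using q_int_mult_real[of q "Suc j"] by (simp add: mult_ac)
    also have "\<dots> = - (real q ^ j * (real q ^ (d - j) - 1)) * w j"
      using power_minus_1_neq_0[OF q, of "Suc j"]
      by (simp add: w_def gauss_binomial_Suc_right Suc_choose_2 power_add)
    also have "\<dots> = (real q - 1) * (- (real q ^ j * ?I (d - j)) * w j)"
      using q_int_mult_real[of q "d - j"] by (simp add: mult_ac)
    finally have "(real q - 1) * (w (Suc j) * ?I (Suc j)) =
      (real q - 1) * (- (real q ^ j * ?I (d - j)) * w j)" .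
    moreover have "real q - 1 \<noteq> 0"
      using q by simp
    ultimately show ?thesis
      using mult_left_cancel by blast
  qed
  consider "i = 0" | "i = 1" | j where "i = Suc (Suc j)"
    by (metis One_nat_def not0_implies_Suc)
  then show ?case
  proof cases
    case 1
    then show ?thesis
      by (simp add: w_def)
  next
    case 2
    then show ?thesis
      using w_Suc[of 0] by (simp add: w_def)
  next
    case 3
    define m where "m = Suc j"
    \<comment> \<open>With these names the recurrence step becomes polynomial, under the relation
      \<open>Q = 1 + (q - 1) * a\<close>.\<close>
    define Q a e g where "Q = real q ^ m" and "a = ?I m" and "e = ?I (d - m)" and "g = ?I (n - d - m)"
    have m: "m < d" "m \<le> n - d" "d - j = Suc (d - m)" "n - d - j = Suc (n - d - m)"
      using 3 less.prems n by (auto simp: m_def)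
    have Q: "Q = 1 + (real q - 1) * a"
      using q_int_mult_real[of q m] by (simp add: Q_def a_def algebra_simps)
    have I_d: "?I d = a + Q * e" and I_nd: "?I (n - d) = a + Q * g"
      using q_int_add[of q m "d - m"] q_int_add[of q m "n - d - m"] m
      by (simp_all add: Q_def a_def e_def g_def)
    have I_Suc: "?I (Suc k) = 1 + real q * ?I k" for k
      using q_int_add[of q 1 k] by (simp add: q_int_def)
    have b_j: "real (?b j) * w j = - Q * (1 + real q * g) * a * w m"
    proof -
      have "real (?b j) * w j = Q * (1 + real q * g) * (real q ^ j * ?I (d - j) * w j)"
        using m by (simp add: grassmann_b_def Q_def m_def g_def I_Suc mult_ac)
      also have "real q ^ j * ?I (d - j) * w j = - (w m * a)"
        using w_Suc[of j] by (simp add: a_def m_def)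
      also have "Q * (1 + real q * g) * - (w m * a) = - Q * (1 + real q * g) * a * w m"
        by simp
      finally show ?thesis .
    qed
    have c_Suc: "w (Suc m) * real (?c (Suc m)) = - (Q * e * (1 + real q * a)) * w m"
      using w_Suc[of m] by (simp add: grassmann_c_def I_Suc Q_def e_def a_def mult.assoc[symmetric])
    have b_m: "real (?b m) = real q * Q * Q * e * g" and b_0: "real (?b 0) = real q * ?I d * ?I (n - d)"
        and c_m: "real (?c m) = a * a"
      by (simp_all add: grassmann_b_def grassmann_c_def Q_def e_def g_def a_def)
    \<comment> \<open>The coefficients of \<open>w m\<close> in the recurrence, once
      \<open>w j\<close> and \<open>w (Suc m)\<close> are replaced by multiples of
      \<open>w m\<close>.\<close>
    have "- ?I d - (real (?b 0) - real (?b m) - real (?c m)) + Q * (1 + real q * g) * a =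
        - (Q * e * (1 + real q * a))"
      unfolding b_m b_0 c_m I_d I_nd using Q by algebra
    then have "(- ?I d - (real (?b 0) - real (?b m) - real (?c m))) * w m - real (?b j) * w j =
        w (Suc m) * real (?c (Suc m))"
      unfolding b_j c_Suc by algebra
    moreover have "real (?c (Suc m)) \<noteq> 0"
      using q_int_pos[of "Suc m" q] by (simp add: grassmann_c_def)
    moreover have "wd_W ?b ?c (- ?I d) m = w m" "wd_W ?b ?c (- ?I d) j = w j"
      using less 3 by (auto simp: m_def)
    ultimately show ?thesis
      using 3 by (simp add: m_def nonzero_divide_eq_eq)
  qed
qed

lemma gauss_binomial_nonneg:
  assumes "2 \<le> q"
  shows "0 \<le> gauss_binomial q n j"
  unfolding gauss_binomial_def using assms by (intro prod_nonneg ballI divide_nonneg_nonneg) (simp_all del: power_Suc)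

theorem wd_bound_grassmann:
  assumes "2 \<le> q" "2 * d \<le> n"
  shows "wd_bound d (grassmann_b q n d) (grassmann_c q) (- real (q_int q d)) = (\<Prod>l<d. 1 + real q ^ l)"
  using q_binomial_theorem[OF assms(1), of 1 d] gauss_binomial_nonneg[OF assms(1)]
  by (simp add: wd_bound_def wd_W_grassmann[OF assms] abs_mult power_abs)


section \<open>Maximal totally singular subspaces of a hyperbolic space\<close>

text \<open>Hyperbolicity is encoded by a witness \<open>E\<close>, totally singular of half the
  dimension, which later also separates the two parity classes. \<open>Q\<close> is a separate
  parameter because in characteristic two its polar form \<open>B\<close> does not determine
  it.\<close>

locale hyperbolic_space = nondegenerate_form B V
  for B :: "'a::{field, finite} ^ 'n::finite \<Rightarrow> 'a ^ 'n \<Rightarrow> 'a" and V :: "('a ^ 'n) set" +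
  fixes Q :: "'a ^ 'n \<Rightarrow> 'a" and E :: "('a ^ 'n) set"
  assumes Q_add: "Q (x + y) = Q x + Q y + B x y"
    and Q_scale: "Q (c *s x) = c * c * Q x"
    and subspace_E: "vec.subspace E"
    and E_subset: "E \<subseteq> V"
    and Q_E: "x \<in> E \<Longrightarrow> Q x = 0"
    and dim_V: "vec.dim V = 2 * vec.dim E"
begin

definition singular_maximals :: "('a ^ 'n) set set" where
  "singular_maximals = {Y \<in> subspaces_of_dim (vec.dim E). Y \<subseteq> V \<and> (\<forall>y\<in>Y. Q y = 0)}"

lemma singular_maximalsD:
  assumes "Y \<in> singular_maximals"
  shows "vec.subspace Y" "vec.dim Y = vec.dim E" "Y \<subseteq> V" "y \<in> Y \<Longrightarrow> Q y = 0"
  using assms by (auto simp: singular_maximals_def subspaces_of_dim_def)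

lemma E_maximal: "E \<in> singular_maximals"
  using subspace_E E_subset Q_E by (auto simp: singular_maximals_def subspaces_of_dim_def)

lemma singular_subset_perp:
  assumes "vec.subspace Y" "Y \<subseteq> V" "\<And>y. y \<in> Y \<Longrightarrow> Q y = 0"
  shows "Y \<subseteq> perp Y"
proof -
  have "B x y = 0" if "x \<in> Y" "y \<in> Y" for x y
    using Q_add[of x y] assms(3) that vec.subspace_add[OF assms(1)] by simp
  then show ?thesis
    using assms(2) by (auto simp: perp_def)
qed

lemma perp_singular_maximal:
  assumes "Y \<in> singular_maximals"
  shows "perp Y = Y"
proof -
  note Y = singular_maximalsD[OF assms]
  have "Y = perp Y"
    using Y dim_perp[OF Y(1,3)] dim_V
    by (intro vec.subspace_dim_equal singular_subset_perp subspace_perp) auto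
  then show ?thesis ..
qed

text \<open>The quotient of \<open>perp U\<close> by \<open>U\<close> is a hyperbolic plane, which
  has two singular lines. One comes from \<open>perp U \<inter> E\<close> and gives
  \<open>Y\<close>; the other gives \<open>Z\<close>, which meets \<open>E\<close> no more than
  \<open>U\<close> does.\<close>

lemma singular_maximals_containing:
  assumes U: "vec.subspace U" "U \<subseteq> V" "\<And>u. u \<in> U \<Longrightarrow> Q u = 0" "Suc (vec.dim U) = vec.dim E"
  obtains Y Z where "{W \<in> singular_maximals. U \<subseteq> W} = {Y, Z}"
    "vec.dim (Y \<inter> E) = Suc (vec.dim (U \<inter> E))" "vec.dim (Z \<inter> E) = vec.dim (U \<inter> E)"
proof -
  define A where "A = perp U \<inter> E"
  define Y where "Y = vec.span (U \<union> A)"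
  have A: "vec.subspace A" "A \<subseteq> E"
    by (auto simp: A_def intro: vec.subspace_inter subspace_perp subspace_E)
  have U_perp: "U \<subseteq> perp U"
    using U by (intro singular_subset_perp)
  have perp_sub: "W \<subseteq> perp U" if "W \<in> singular_maximals" "U \<subseteq> W" for W
    using perp_antimono[OF that(2)] perp_singular_maximal[OF that(1)] by simp
  \<comment> \<open>Since \<open>E\<close> is its own \<open>perp\<close>, \<open>A\<close> is the
    \<open>perp\<close> of \<open>U + E\<close>; this determines its dimension.\<close>
  have "perp (vec.span (U \<union> E)) = A"
    unfolding perp_span perp_Un A_def using perp_singular_maximal[OF E_maximal] by simp
  moreover have "vec.span (U \<union> E) \<subseteq> V"
    using U E_subset by (intro vec.span_minimal subspace_V) auto
  ultimately have "vec.dim A + vec.dim (vec.span (U \<union> E)) = 2 * vec.dim E"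
    using dim_perp[of "vec.span (U \<union> E)"] dim_V by simp
  then have dim_A: "vec.dim A = Suc (vec.dim (U \<inter> E))"
    using dim_span_Un[OF U(1) subspace_E] U(4) by linarith
  have "U \<inter> A = U \<inter> E"
    using U_perp by (auto simp: A_def)
  then have dim_Y: "vec.dim Y = vec.dim E"
    using dim_span_Un[OF U(1) A(1)] dim_A U(4) by (simp add: Y_def)
  have Q_Y: "Q y = 0" if y: "y \<in> Y" for y
  proof -
    obtain u a where "y = u + a" "u \<in> U" "a \<in> A"
      using y U(1) A(1) unfolding Y_def vec.span_Un by (auto simp: vec.span_eq_iff[THEN iffD2])
    then show ?thesis
      using U(3) Q_E A(2) by (auto simp: Q_add A_def perp_def)
  qed
  have UA_Y: "U \<subseteq> Y" "A \<subseteq> Y"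
    unfolding Y_def using vec.span_superset[of "U \<union> A"] by auto
  have Y_V: "Y \<subseteq> V"
    unfolding Y_def using U(2) A(2) E_subset by (intro vec.span_minimal subspace_V) auto
  have Y_max: "Y \<in> singular_maximals"
    using dim_Y Q_Y Y_V by (auto simp: singular_maximals_def subspaces_of_dim_def Y_def)
  have subspace_Y: "vec.subspace Y"
    by (simp add: Y_def)
  have Y_E: "Y \<inter> E = A"
    using perp_sub[OF Y_max UA_Y(1)] UA_Y(2) by (auto simp: A_def)
  have dim_perp_U: "vec.dim (perp U) = Suc (vec.dim Y)"
    using dim_perp[OF U(1,2)] dim_V U(4) dim_Y by linarith
  have "\<not> perp U \<subseteq> Y"
    using vec.dim_subset[of "perp U" Y] dim_perp_U by auto
  then obtain w where w: "w \<in> perp U" "w \<notin> Y"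
    by blast
  have "\<not> Y \<subseteq> U"
    using vec.dim_subset[of Y U] dim_Y U(4) by auto
  then obtain y0 where y0: "y0 \<in> Y" "y0 \<notin> U"
    by blast
  have Y_eq: "Y = vec.span (insert y0 U)"
    using U(1) subspace_Y UA_Y(1) y0 dim_Y U(4) by (intro adjoin_unique) auto
  \<comment> \<open>Otherwise \<open>w\<close> would be orthogonal to \<open>Y\<close>, which is its
    own \<open>perp\<close>.\<close>
  have B_y0_w: "B y0 w \<noteq> 0"
  proof
    assume "B y0 w = 0"
    then have "w \<in> perp (insert y0 U)"
      using w(1) by (auto simp: perp_def)
    then have "w \<in> perp Y"
      unfolding Y_eq perp_span .
    then show False
      using w(2) perp_singular_maximal[OF Y_max] by simp
  qed
  have B_y0_y0: "B y0 y0 = 0"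
    using perp_singular_maximal[OF Y_max] y0(1) by (auto simp: perp_def)
  have y0_perp: "y0 \<in> perp U"
    using perp_sub[OF Y_max UA_Y(1)] y0(1) by auto
  \<comment> \<open>The coefficient solves \<open>Q (w + c *s y0) = 0\<close>, an equation linear in
    \<open>c\<close> because \<open>y0\<close> is singular.\<close>
  define c where "c = - Q w / B y0 w"
  define z where "z = w + c *s y0"
  have z_perp: "z \<in> perp U"
    unfolding z_def using w(1) y0_perp subspace_perp by (intro vec.subspace_add vec.subspace_scale)
  have z_Y: "z \<notin> Y"
  proof
    assume "z \<in> Y"
    then have "z - c *s y0 \<in> Y"
      using subspace_Y y0(1) by (intro vec.subspace_diff vec.subspace_scale)
    then show False
      using w(2) by (simp add: z_def)
  qed
  have B_y0_z: "B y0 z = B y0 w"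
    by (simp add: z_def add_right scale_right B_y0_y0)
  have "c * B y0 w = - Q w"
    using B_y0_w by (simp add: c_def)
  then have Q_z: "Q z = 0"
    using Q_Y[OF y0(1)] by (simp add: z_def Q_add Q_scale scale_right sym[of w])
  define Z where "Z = vec.span (insert z U)"
  have z_U: "z \<notin> U"
    using z_Y UA_Y(1) by auto
  have subspace_Z: "vec.subspace Z" and U_Z: "U \<subseteq> Z" and z_Z: "z \<in> Z"
    unfolding Z_def using vec.span_superset[of "insert z U"] by auto
  have Z_decomp: "\<exists>u k. u \<in> U \<and> t = u + k *s z" if t: "t \<in> Z" for t
  proof -
    obtain k where "t - k *s z \<in> U"
      using t U(1) unfolding Z_def vec.span_breakdown_eq by (auto simp: vec.span_eq_iff[THEN iffD2])
    then show ?thesis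
      by (intro exI[of _ "t - k *s z"] exI[of _ k]) simp
  qed
  have Q_Z: "Q t = 0" if t: "t \<in> Z" for t
  proof -
    obtain u k where "u \<in> U" "t = u + k *s z"
      using Z_decomp[OF t] by blast
    then show ?thesis
      using U(3) z_perp Q_z by (auto simp: Q_add Q_scale scale_right perp_def)
  qed
  have Z_perp: "Z \<subseteq> perp U"
    unfolding Z_def using z_perp U_perp by (intro vec.span_minimal subspace_perp) auto
  have Z_max: "Z \<in> singular_maximals"
    using subspace_Z Q_Z Z_perp perp_subset[of U] dim_adjoin[OF U(1) z_U] U(4)
    by (auto simp: singular_maximals_def subspaces_of_dim_def Z_def)
  \<comment> \<open>A vector of \<open>Z \<inter> E\<close> lies in
    \<open>perp U \<inter> E\<close>, hence in \<open>Y\<close>; as \<open>z\<close> is not in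
    \<open>Y\<close>, its component along \<open>z\<close> vanishes.\<close>
  have "Z \<inter> E = U \<inter> E"
  proof (intro equalityI subsetI)
    fix t assume t: "t \<in> Z \<inter> E"
    then have "t \<in> Y"
      using Z_perp UA_Y(2) by (auto simp: A_def)
    obtain u k where uk: "u \<in> U" "t = u + k *s z"
      using Z_decomp[of t] t by blast
    have "k = 0"
    proof (rule ccontr)
      assume "k \<noteq> 0"
      then have "z = inverse k *s (t - u)"
        by (simp add: uk(2) vector_smult_assoc)
      also have "\<dots> \<in> Y"
        using \<open>t \<in> Y\<close> uk(1) UA_Y(1) subspace_Y by (intro vec.subspace_scale vec.subspace_diff) auto
      finally show False
        using z_Y by contradiction
    qed
    then show "t \<in> U \<inter> E"
      using t uk by simp
  qed (use U_Z in auto)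
  moreover have "{W \<in> singular_maximals. U \<subseteq> W} = {Y, Z}"
  proof -
    \<comment> \<open>A vector \<open>v\<close> of \<open>W\<close> outside \<open>U\<close> is
      \<open>u + l *s y0 + k *s z\<close> with \<open>Q v = l * k * B y0 z\<close>; singularity
      forces \<open>k = 0\<close> or \<open>l = 0\<close>, which puts \<open>v\<close> in
      \<open>Y\<close> or in \<open>Z\<close> respectively.\<close>
    have "W = Y \<or> W = Z" if W: "W \<in> singular_maximals" "U \<subseteq> W" for W
    proof -
      note W' = singular_maximalsD[OF W(1)]
      have "\<not> W \<subseteq> U"
        using vec.dim_subset[of W U] W'(2) U(4) by auto
      then obtain v where v: "v \<in> W" "v \<notin> U"
        by blast
      have W_eq: "W' = vec.span (insert v U)"
        if "W' \<in> singular_maximals" "U \<subseteq> W'" "v \<in> W'" for W'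
        using that singular_maximalsD[OF that(1)] U(1,4) v(2) by (intro adjoin_unique) auto
      have "perp U = vec.span (insert z Y)"
        using subspace_Y subspace_perp perp_sub[OF Y_max UA_Y(1)] z_perp z_Y dim_perp_U
        by (intro adjoin_unique)
      then have "v \<in> vec.span (insert z Y)"
        using perp_sub[OF W] v(1) by auto
      then obtain k where "v - k *s z \<in> Y"
        unfolding vec.span_breakdown_eq using subspace_Y by (auto simp: vec.span_eq_iff[THEN iffD2])
      then obtain l where l: "v - k *s z - l *s y0 \<in> U"
        unfolding Y_eq vec.span_breakdown_eq using U(1) by (auto simp: vec.span_eq_iff[THEN iffD2])
      define u where "u = v - k *s z - l *s y0"
      have u: "u \<in> U" and v_eq: "v = u + (l *s y0 + k *s z)"
        using l by (simp_all add: u_def)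
      have "l *s y0 + k *s z \<in> perp U"
        using y0_perp z_perp subspace_perp by (intro vec.subspace_add vec.subspace_scale)
      then have "B u (l *s y0 + k *s z) = 0"
        using u by (auto simp: perp_def)
      then have "Q v = l * k * B y0 z"
        unfolding v_eq Q_add[of u] using U(3)[OF u] Q_Y[OF y0(1)] Q_z
        by (simp add: Q_add Q_scale scale_left scale_right mult_ac)
      then have "l = 0 \<or> k = 0"
        using W'(4)[OF v(1)] B_y0_z B_y0_w by auto
      then show ?thesis
      proof
        assume "k = 0"
        then have "v \<in> Y"
          unfolding v_eq using u UA_Y(1) y0(1) subspace_Y
          by (auto intro!: vec.subspace_add vec.subspace_scale)
        then show ?thesis
          using W_eq[OF W v(1)] W_eq[OF Y_max UA_Y(1)] by simp
      next
        assume "l = 0"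
        then have "v \<in> Z"
          unfolding v_eq using u U_Z z_Z subspace_Z
          by (auto intro!: vec.subspace_add vec.subspace_scale)
        then show ?thesis
          using W_eq[OF W v(1)] W_eq[OF Z_max U_Z] by simp
      qed
    qed
    then show ?thesis
      using Y_max Z_max UA_Y(1) U_Z by blast
  qed
  ultimately show ?thesis
    using that[of Y Z] dim_A Y_E by simp
qed

text \<open>Together with \<open>odd_maximals\<close> these are the two classical families of
  generators of a hyperbolic quadric.\<close>

definition even_maximals :: "('a ^ 'n) set set" where
  "even_maximals = {Y \<in> singular_maximals. even (vec.dim E - vec.dim (Y \<inter> E))}"

definition odd_maximals :: "('a ^ 'n) set set" where
  "odd_maximals = {Y \<in> singular_maximals. odd (vec.dim E - vec.dim (Y \<inter> E))}"

lemma maximals_Un: "even_maximals \<union> odd_maximals = singular_maximals"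
  by (auto simp: even_maximals_def odd_maximals_def)

lemma card_maximals_containing:
  assumes U: "vec.subspace U" "U \<subseteq> V" "\<And>u. u \<in> U \<Longrightarrow> Q u = 0" "Suc (vec.dim U) = vec.dim E"
  shows "card {W \<in> even_maximals. U \<subseteq> W} = 1 \<and> card {W \<in> odd_maximals. U \<subseteq> W} = 1"
proof -
  obtain Y Z where YZ: "{W \<in> singular_maximals. U \<subseteq> W} = {Y, Z}"
    "vec.dim (Y \<inter> E) = Suc (vec.dim (U \<inter> E))" "vec.dim (Z \<inter> E) = vec.dim (U \<inter> E)"
    using singular_maximals_containing[OF U] by blast
  \<comment> \<open>Strictness keeps the two truncated differences consecutive, hence of opposite
    parity.\<close>
  have "vec.dim (U \<inter> E) < vec.dim E"
    using vec.dim_subset[of "U \<inter> E" U] U(4) by simp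
  then have "even (vec.dim E - vec.dim (Y \<inter> E)) \<longleftrightarrow> odd (vec.dim E - vec.dim (Z \<inter> E))"
    unfolding YZ(2,3) by auto
  moreover have "{W \<in> even_maximals. U \<subseteq> W} = {W \<in> {Y, Z}. even (vec.dim E - vec.dim (W \<inter> E))}"
    "{W \<in> odd_maximals. U \<subseteq> W} = {W \<in> {Y, Z}. odd (vec.dim E - vec.dim (W \<inter> E))}"
    unfolding YZ(1)[symmetric] by (auto simp: even_maximals_def odd_maximals_def)
  ultimately consider "{W \<in> even_maximals. U \<subseteq> W} = {Y}" "{W \<in> odd_maximals. U \<subseteq> W} = {Z}"
    | "{W \<in> even_maximals. U \<subseteq> W} = {Z}" "{W \<in> odd_maximals. U \<subseteq> W} = {Y}"
    by (cases "even (vec.dim E - vec.dim (Y \<inter> E))") auto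
  then show ?thesis
    by cases simp_all
qed

lemma steiner_bitrade_maximals:
  assumes d: "0 < vec.dim E"
  shows "steiner_bitrade (vec.dim E) even_maximals odd_maximals"
proof -
  let ?d = "vec.dim E"
  have "card (C \<inter> even_maximals) = 1 \<and> card (C \<inter> odd_maximals) = 1 \<or>
      C \<inter> even_maximals = {} \<and> C \<inter> odd_maximals = {}" if clique: "C \<in> grassmann_cliques ?d" for C
  proof -
    obtain U where U: "U \<in> subspaces_of_dim (?d - 1)" and C: "C = {X \<in> subspaces_of_dim ?d. U \<subseteq> X}"
      using clique by (auto simp: grassmann_cliques_def)
    have int: "C \<inter> even_maximals = {W \<in> even_maximals. U \<subseteq> W}" "C \<inter> odd_maximals = {W \<in> odd_maximals. U \<subseteq> W}"
      by (auto simp: C even_maximals_def odd_maximals_def singular_maximals_def)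
    \<comment> \<open>A clique around a totally singular \<open>U\<close> inside \<open>V\<close>
      has one member of each parity; any other clique has none, because every subspace of a member
      is totally singular.\<close>
    show ?thesis
    proof (cases "U \<subseteq> V \<and> (\<forall>u\<in>U. Q u = 0)")
      case True
      then have "card {W \<in> even_maximals. U \<subseteq> W} = 1 \<and> card {W \<in> odd_maximals. U \<subseteq> W} = 1"
        using U d by (intro card_maximals_containing) (auto simp: subspaces_of_dim_def)
      then show ?thesis
        unfolding int by blast
    next
      case False
      then have "\<not> U \<subseteq> W" if "W \<in> singular_maximals" for W
        using singular_maximalsD[OF that] by blast
      then show ?thesis
        unfolding int by (auto simp: even_maximals_def odd_maximals_def)
    qed
  qed
  moreover have "E \<in> even_maximals"
    using E_maximal by (simp add: even_maximals_def)
  \<comment> \<open>A hyperplane of \<open>E\<close> lies in a maximal of each parity.\<close>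
  moreover have "odd_maximals \<noteq> {}"
  proof -
    obtain U where U: "vec.subspace U" "U \<subseteq> vec.span E" "vec.dim U = ?d - 1"
      using vec.choose_subspace_of_subspace[of "?d - 1" E] by auto
    then have "U \<subseteq> E"
      using subspace_E by (simp add: vec.span_eq_iff[THEN iffD2])
    then have "card {W \<in> odd_maximals. U \<subseteq> W} = 1"
      using card_maximals_containing[of U] U d E_subset Q_E by auto
    then show ?thesis
      by (metis (no_types, lifting) Collect_empty_eq card.empty empty_iff zero_neq_one)
  qed
  moreover have "even_maximals \<subseteq> subspaces_of_dim ?d" "odd_maximals \<subseteq> subspaces_of_dim ?d"
    "even_maximals \<inter> odd_maximals = {}"
    by (auto simp: even_maximals_def odd_maximals_def singular_maximals_def)
  ultimately show ?thesis
    by (auto simp: steiner_bitrade_def)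
qed

text \<open>
  On \<open>{Y. Y \<inter> E = U}\<close> the sign is constant, so the signed count \<open>bitrade_sign_sphere\<close> is
  already the count of these subspaces.
\<close>

lemma card_maximals:
  assumes d: "0 < vec.dim E"
  shows "real (card singular_maximals) = (\<Prod>l<vec.dim E. 1 + real CARD('a) ^ l)"
proof -
  let ?d = "vec.dim E" and ?s = "bitrade_sign even_maximals odd_maximals"
  note T = steiner_bitrade_maximals[OF d]
  have s: "?s Y = (- 1) ^ (?d - vec.dim (Y \<inter> E))" if "Y \<in> singular_maximals" for Y
    using that by (auto simp: bitrade_sign_def even_maximals_def odd_maximals_def)
  have sphere: "real (card {Y \<in> singular_maximals. Y \<inter> E = U}) = real CARD('a) ^ ((?d - vec.dim U) choose 2)"
    if U: "vec.subspace U" "U \<subseteq> E" for U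
  proof -
    let ?\<epsilon> = "(- 1 :: real) ^ (?d - vec.dim U)"
    have "real (card {Y \<in> singular_maximals. Y \<inter> E = U}) * ?\<epsilon> = (\<Sum>Y | Y \<in> singular_maximals \<and> Y \<inter> E = U. ?s Y)"
      using s by simp
    also have "\<dots> = ?\<epsilon> * real CARD('a) ^ ((?d - vec.dim U) choose 2) * ?s E"
      using bitrade_sign_sphere[OF T _ U] E_maximal unfolding maximals_Un by blast
    also have "?s E = 1"
      using s[OF E_maximal] by simp
    finally show ?thesis
      by simp
  qed
  have sub: "singular_maximals \<subseteq> subspaces_of_dim ?d" and E: "E \<in> subspaces_of_dim ?d"
    using E_maximal by (auto simp: singular_maximals_def)
  have "real (card singular_maximals) =
      (\<Sum>V | vec.subspace V \<and> {0} \<subseteq> V \<and> V \<subseteq> E. real (card {Y \<in> singular_maximals. Y \<inter> E = V}))"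
    using card_eq_sum_spheres[OF sub subspace_E] by simp
  also have "\<dots> = (\<Sum>V | vec.subspace V \<and> {0} \<subseteq> V \<and> V \<subseteq> E. real CARD('a) ^ ((?d - vec.dim V) choose 2))"
    by (intro sum.cong) (auto simp: sphere)
  also have "\<dots> = (\<Prod>l<?d. 1 + real CARD('a) ^ l)"
    by (rule sum_choose_2_intermediate_subspaces[OF E])
  finally show ?thesis .
qed

end


section \<open>Coordinates\<close>

text \<open>
  The hyperbolic space of dimension \<open>2 * CARD('m)\<close> sits in \<open>'a ^ 'n\<close> on the coordinates in the
  range of an injection \<open>e\<close>.
\<close>

lemma hyperbolic_space_coordinates:
  fixes e :: "'m::finite + 'm \<Rightarrow> 'n::finite"
  assumes e: "inj e"
  shows "hyperbolic_space
    (\<lambda>x y :: 'a::{field, finite} ^ 'n. \<Sum>i\<in>UNIV. x $ e (Inl i) * y $ e (Inr i) + x $ e (Inr i) * y $ e (Inl i))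
    {w. \<forall>j. j \<notin> range e \<longrightarrow> w $ j = 0}
    (\<lambda>w. \<Sum>i\<in>UNIV. w $ e (Inl i) * w $ e (Inr i))
    {w. \<forall>j. j \<notin> range (\<lambda>i. e (Inl i)) \<longrightarrow> w $ j = 0}"
    (is "hyperbolic_space ?B ?V ?Q ?E")
proof
  have e_eq: "e a = e b \<longleftrightarrow> a = b" for a b
    using e by (auto dest: injD)
  show "vec.subspace ?V" "vec.subspace ?E"
    by (auto simp: vec.subspace_def)
  show "?B x y = ?B y x" for x y
    by (simp add: add.commute mult.commute)
  show "?B (x + y) z = ?B x z + ?B y z" for x y z
    by (simp add: distrib_right sum.distrib algebra_simps)
  show "?B (c *s x) y = c * ?B x y" for c x y
    by (simp add: sum_distrib_left algebra_simps)
  show "?Q (x + y) = ?Q x + ?Q y + ?B x y" for x y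
    by (simp add: sum.distrib algebra_simps)
  show "?Q (c *s x) = c * c * ?Q x" for c x
    by (simp add: sum_distrib_left mult_ac)
  show "?E \<subseteq> ?V"
    by auto
  show "?Q x = 0" if x: "x \<in> ?E" for x
  proof -
    have "x $ e (Inr i) = 0" for i
      using x e_eq by auto
    then show ?thesis
      by simp
  qed
  show "vec.dim ?V = 2 * vec.dim ?E"
  proof -
    have "card (range e) = 2 * CARD('m)"
      using e by (simp add: card_image card_UNIV_sum)
    moreover have "card (range (\<lambda>i. e (Inl i))) = CARD('m)"
      by (intro card_image injI) (simp add: e_eq)
    ultimately show ?thesis
      by (simp add: dim_substandard_cart)
  qed
  show "w = 0" if w: "w \<in> ?V" and null: "\<And>u. u \<in> ?V \<Longrightarrow> ?B u w = 0" for w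
  proof -
    \<comment> \<open>A unit vector at one coordinate of a pair reads off the other
      coordinate.\<close>
    have axis_V: "axis (e a) 1 \<in> ?V" for a
      by (auto simp: axis_def)
    have "?B (axis (e (Inl i)) 1) w = w $ e (Inr i)" "?B (axis (e (Inr i)) 1) w = w $ e (Inl i)" for i
      by (simp_all add: axis_def e_eq if_distrib[of "\<lambda>x. x * _"] cong: if_cong)
    then have "w $ e (Inr i) = 0" "w $ e (Inl i) = 0" for i
      using null[OF axis_V] by metis+
    then have "w $ e a = 0" for a
      by (cases a) auto
    then have "w $ j = 0" for j
      using w by (cases "j \<in> range e") auto
    then show ?thesis
      by (simp add: vec_eq_iff)
  qed
qed

text \<open>\<open>W\<close> is spelled out in coordinates so that for the identity \<open>e\<close>
  it can be recognised as \<open>dual_polar_verts\<close>; other injections place a bitrade of the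
  same size in a larger space.\<close>

lemma extremal_bitrade_exists:
  fixes e :: "'m::finite + 'm \<Rightarrow> 'n::finite"
  assumes e: "inj e"
  defines "W \<equiv> {Y \<in> subspaces_of_dim CARD('m). Y \<subseteq> {w. \<forall>j. j \<notin> range e \<longrightarrow> w $ j = 0} \<and>
    (\<forall>w\<in>Y. (\<Sum>i\<in>UNIV. w $ e (Inl i) * w $ e (Inr i)) = (0 :: 'a::{field, finite}))}"
  obtains T0 T1 where "T0 \<union> T1 = W" "steiner_bitrade CARD('m) T0 T1"
    "real (card (T0 \<union> T1)) = (\<Prod>l<CARD('m). 1 + real CARD('a) ^ l)"
proof -
  interpret hyperbolic_space
    "\<lambda>x y :: 'a ^ 'n. \<Sum>i\<in>UNIV. x $ e (Inl i) * y $ e (Inr i) + x $ e (Inr i) * y $ e (Inl i)"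
    "{w. \<forall>j. j \<notin> range e \<longrightarrow> w $ j = 0}"
    "\<lambda>w. \<Sum>i\<in>UNIV. w $ e (Inl i) * w $ e (Inr i)"
    "{w. \<forall>j. j \<notin> range (\<lambda>i. e (Inl i)) \<longrightarrow> w $ j = 0}"
    using e by (rule hyperbolic_space_coordinates)
  have "card (range (\<lambda>i. e (Inl i))) = CARD('m)"
    using e by (intro card_image injI) (auto dest: injD)
  then have dim: "vec.dim {w :: 'a ^ 'n. \<forall>j. j \<notin> range (\<lambda>i. e (Inl i)) \<longrightarrow> w $ j = 0} = CARD('m)"
    by (simp add: dim_substandard_cart)
  have "W = singular_maximals"
    by (simp add: W_def singular_maximals_def dim)
  then show ?thesis
    using that[OF maximals_Un[folded \<open>W = singular_maximals\<close>]] steiner_bitrade_maximals card_maximals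
    unfolding dim maximals_Un by simp
qed

lemma dual_polar_distance_regular:
  "distance_regular_with (dual_polar_graph :: ('a::{field, finite} ^ ('m::finite + 'm)) set graph) CARD('m)
    (\<lambda>i. CARD('a) ^ i * q_int CARD('a) (CARD('m) - i)) (q_int CARD('a))"
proof -
  \<comment> \<open>With \<open>e\<close> the identity every coordinate is in its range, and the sum
    over pairs is \<open>hyperbolic_form\<close>.\<close>
  obtain T0 T1 :: "('a ^ ('m + 'm)) set set" where T: "T0 \<union> T1 = dual_polar_verts"
    "steiner_bitrade CARD('m) T0 T1"
    "real (card (T0 \<union> T1)) = (\<Prod>l<CARD('m). 1 + real CARD('a) ^ l)"
    using extremal_bitrade_exists[OF inj_on_id, where ?'a = 'a and ?'m = 'm]
    by (auto simp: dual_polar_verts_def hyperbolic_form_def)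
  have "dual_polar_graph = induced_subgraph (grassmann_graph CARD('m)) (T0 \<union> T1)"
    unfolding T(1)
    by (auto simp: dual_polar_graph_def induced_subgraph_def grassmann_graph_def dual_polar_verts_def)
  then show ?thesis
    using extremal_bitrade_distance_regular[OF _ T(2,3)] by simp
qed

section \<open>Bipartiteness and assembly of the results\<close>

text \<open>Adjacent members both lie in the clique of the \<open>d\<close>-subspaces above their
  intersection, and a clique has at most one member in each part.\<close>

lemma bitrade_bipartite:
  fixes T0 T1 :: "('a::{field, finite} ^ 'n::finite) set set"
  assumes d: "0 < d" and T: "steiner_bitrade d T0 T1"
  shows "bipartite (induced_subgraph (grassmann_graph d) (T0 \<union> T1))"
proof -
  have indep: "vec.dim (X \<inter> Y) \<noteq> d - 1"
    if XY: "X \<in> Ti" "Y \<in> Ti" and Ti: "Ti = T0 \<or> Ti = T1" for X Y Ti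
  proof
    assume dim: "vec.dim (X \<inter> Y) = d - 1"
    let ?C = "{Z \<in> subspaces_of_dim d. X \<inter> Y \<subseteq> Z}"
    have sub: "X \<in> subspaces_of_dim d" "Y \<in> subspaces_of_dim d"
      using T XY Ti by (auto simp: steiner_bitrade_def)
    then have "X \<inter> Y \<in> subspaces_of_dim (d - 1)"
      using dim by (auto simp: subspaces_of_dim_def intro: vec.subspace_inter)
    then have "?C \<in> grassmann_cliques d"
      by (auto simp: grassmann_cliques_def)
    moreover have "X \<in> ?C \<inter> Ti" "Y \<in> ?C \<inter> Ti"
      using sub XY by auto
    ultimately have "card (?C \<inter> Ti) = 1"
      using T Ti by (auto simp: steiner_bitrade_def)
    then have "X = Y"
      using \<open>X \<in> ?C \<inter> Ti\<close> \<open>Y \<in> ?C \<inter> Ti\<close> by (metis card_1_singletonE singletonD)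
    then show False
      using dim sub d by (auto simp: subspaces_of_dim_def)
  qed
  show ?thesis
    unfolding bipartite_def
  proof (intro exI conjI)
    show "T0 \<union> T1 = verts (induced_subgraph (grassmann_graph d) (T0 \<union> T1))"
      by (simp add: induced_subgraph_def)
    show "T0 \<inter> T1 = {}"
      using T by (simp add: steiner_bitrade_def)
    show "adj (induced_subgraph (grassmann_graph d) (T0 \<union> T1)) \<inter> (T0 \<times> T0 \<union> T1 \<times> T1) = {}"
      using indep[of _ T0] indep[of _ T1] by (auto simp: induced_subgraph_def grassmann_graph_def)
  qed
qed

lemma prod_descending_powers:
  "real (\<Prod>i=1..d. (q ^ (d - i) + 1)) = (\<Prod>l<d. 1 + real q ^ l)"
proof -
  have "(\<Prod>i=1..d. (q ^ (d - i) + 1)) = (\<Prod>l<d. q ^ (d - Suc l) + 1)"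
    by (simp only: One_nat_def prod.atLeast1_atMost_eq)
  also have "\<dots> = (\<Prod>l<d. q ^ l + 1)"
    by (rule prod.nat_diff_reindex)
  finally show ?thesis
    by (simp add: add.commute)
qed

theorem theorem5:
  fixes q n d :: nat and k s \<theta> :: real
  assumes "CARD('a::{field, finite}) = q"
    and "CARD('n::finite) = n"
    and "CARD('m::finite) = d"
    and "n \<ge> 2 * d" and "2 * d \<ge> 2"
    and "k = real q * gauss_binomial q d 1 * gauss_binomial q (n - d) 1"
    and "s + 1 = gauss_binomial q (n - d + 1) 1"
    and "\<theta> = - k / s"
  shows
    "(\<exists>(T0 :: ('a ^ 'n) set set) T1. minimum_steiner_bitrade d T0 T1) \<and>
     (\<forall>(T0 :: ('a ^ 'n) set set) T1. minimum_steiner_bitrade d T0 T1 \<longrightarrow>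
        card (T0 \<union> T1) = (\<Prod>i=1..d. (q ^ (d - i) + 1))) \<and>
     real (\<Prod>i=1..d. (q ^ (d - i) + 1)) = (\<Sum>i=0..d. real q ^ (i choose 2) * gauss_binomial q d i) \<and>
     (\<exists>D b c. distance_regular_with (grassmann_graph d :: ('a ^ 'n) set graph) D b c \<and>
        real (b 0) = k \<and>
        real (\<Prod>i=1..d. (q ^ (d - i) + 1)) = wd_bound D b c \<theta>) \<and>
     (\<forall>(T0 :: ('a ^ 'n) set set) T1. minimum_steiner_bitrade d T0 T1 \<longrightarrow>
        bipartite (induced_subgraph (grassmann_graph d) (T0 \<union> T1)) \<and>
        (\<exists>D b c.
           distance_regular_with (induced_subgraph (grassmann_graph d) (T0 \<union> T1)) D b c \<and>
           distance_regular_with (dual_polar_graph :: ('a ^ ('m + 'm)) set graph) D b c))"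
proof -
  let ?M = "\<Prod>i=1..d. (q ^ (d - i) + 1)"
  have q: "2 \<le> q"
    using card_field_ge_2[where 'a = 'a] assms(1) by simp
  have d: "0 < d" "2 * d \<le> n" "0 < n - d"
    using assms(4,5) by auto
  have M: "real ?M = (\<Prod>l<d. 1 + real q ^ l)"
    by (rule prod_descending_powers)
  have exists: "\<exists>(S0 :: ('a ^ 'n) set set) S1. steiner_bitrade d S0 S1 \<and> card (S0 \<union> S1) = ?M"
  proof -
    \<comment> \<open>\<open>2 * d \<le> n\<close> leaves room for the coordinates of the hyperbolic
      space.\<close>
    have "card (UNIV :: ('m + 'm) set) \<le> card (UNIV :: 'n set)"
      using assms(2,3) d(2) by (simp add: card_UNIV_sum)
    then obtain e :: "'m + 'm \<Rightarrow> 'n" where e: "inj e"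
      using card_le_inj[of "UNIV :: ('m + 'm) set" "UNIV :: 'n set"] by auto
    obtain S0 S1 :: "('a ^ 'n) set set" where
      "steiner_bitrade CARD('m) S0 S1" "real (card (S0 \<union> S1)) = (\<Prod>l<CARD('m). 1 + real CARD('a) ^ l)"
      by (rule extremal_bitrade_exists[OF e, where ?'a = 'a]) blast
    then show ?thesis
      using assms(1,3) M by (metis of_nat_eq_iff)
  qed
  have bound: "?M \<le> card (S0 \<union> S1)" if "steiner_bitrade d S0 S1" for S0 S1 :: "('a ^ 'n) set set"
  proof -
    have "real ?M \<le> real (card (S0 \<union> S1))"
      unfolding M using bitrade_card_ge[OF that] assms(1) by simp
    then show ?thesis
      by (simp only: of_nat_le_iff)
  qed
  \<comment> \<open>Because the lower bound is attained, minimality amounts to having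
    \<open>?M\<close> members, so the equality case covers every minimum bitrade.\<close>
  have extremal: "minimum_steiner_bitrade d T0 T1 \<longleftrightarrow> steiner_bitrade d T0 T1 \<and> card (T0 \<union> T1) = ?M"
    for T0 T1 :: "('a ^ 'n) set set"
    using exists bound unfolding minimum_steiner_bitrade_def by (metis order_antisym)
  have k: "k = real q * real (q_int q d) * real (q_int q (n - d))"
    using assms(6) gauss_binomial_1[OF q] by simp
  \<comment> \<open>\<open>q_int q (n - d + 1) = 1 + q * q_int q (n - d)\<close>, so
    \<open>k / s\<close> is \<open>q_int q d\<close> and \<open>\<theta>\<close> is the argument
    treated in \<open>wd_W_grassmann\<close>.\<close>
  have "s = real q * real (q_int q (n - d))"
    using assms(7) gauss_binomial_1[OF q] q_int_add[of q 1 "n - d"] d by (simp add: Suc_diff_le)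
  moreover have "real q * real (q_int q (n - d)) \<noteq> 0"
    using q q_int_pos[OF d(3), of q] by simp
  ultimately have \<theta>: "\<theta> = - real (q_int q d)"
    using assms(8) k by simp
  have n: "CARD('n) = n" and m: "CARD('m) = d" and a: "CARD('a) = q"
    by fact+
  show ?thesis
  proof (intro conjI)
    show "\<exists>(T0 :: ('a ^ 'n) set set) T1. minimum_steiner_bitrade d T0 T1"
      using exists by (simp add: extremal)
    show "\<forall>(T0 :: ('a ^ 'n) set set) T1. minimum_steiner_bitrade d T0 T1 \<longrightarrow> card (T0 \<union> T1) = ?M"
      by (simp add: extremal)
    show "real ?M = (\<Sum>i=0..d. real q ^ (i choose 2) * gauss_binomial q d i)"
      using q_binomial_theorem[OF q, of 1 d] unfolding M by (simp add: atMost_atLeast0)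
    show "\<exists>D b c. distance_regular_with (grassmann_graph d :: ('a ^ 'n) set graph) D b c \<and>
        real (b 0) = k \<and> real ?M = wd_bound D b c \<theta>"
    proof (intro exI conjI)
      show "distance_regular_with (grassmann_graph d :: ('a ^ 'n) set graph) d
          (grassmann_b q n d) (grassmann_c q)"
        using grassmann_distance_regular[where 'a = 'a and 'n = 'n and d = d] d n a by simp
      show "real (grassmann_b q n d 0) = k"
        by (simp add: grassmann_b_def k)
      show "real ?M = wd_bound d (grassmann_b q n d) (grassmann_c q) \<theta>"
        unfolding M \<theta> using wd_bound_grassmann[OF q d(2)] ..
    qed
    show "\<forall>(T0 :: ('a ^ 'n) set set) T1. minimum_steiner_bitrade d T0 T1 \<longrightarrow>
        bipartite (induced_subgraph (grassmann_graph d) (T0 \<union> T1)) \<and>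
        (\<exists>D b c.
           distance_regular_with (induced_subgraph (grassmann_graph d) (T0 \<union> T1)) D b c \<and>
           distance_regular_with (dual_polar_graph :: ('a ^ ('m + 'm)) set graph) D b c)"
    proof (intro allI impI)
      fix T0 T1 :: "('a ^ 'n) set set"
      assume "minimum_steiner_bitrade d T0 T1"
      then have T: "steiner_bitrade d T0 T1" "real (card (T0 \<union> T1)) = (\<Prod>l<d. 1 + real CARD('a) ^ l)"
        using M by (simp_all add: extremal a)
      show "bipartite (induced_subgraph (grassmann_graph d) (T0 \<union> T1)) \<and>
        (\<exists>D b c.
           distance_regular_with (induced_subgraph (grassmann_graph d) (T0 \<union> T1)) D b c \<and>
           distance_regular_with (dual_polar_graph :: ('a ^ ('m + 'm)) set graph) D b c)"
        using bitrade_bipartite[OF d(1) T(1)] extremal_bitrade_distance_regular[OF d(1) T]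
          dual_polar_distance_regular[where 'a = 'a and 'm = 'm] unfolding m by blast
    qed
  qed
qed

end
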